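(* Let $a,b\in\mathbb{C}$ with $\Re(a)<1$, $\Re(b)<1$ and $\Re(a+b)<1$. Then $$\sum_{j=0}^\infty\sum_{k=0}^\infty \frac{(a)_j\,(b)_k}{j!\,k!\,(j+k+1)}\,\zeta(a+j)\,\zeta(b+k)=\frac{\pi\,\Gamma(a+b-1)\,\zeta(a+b-1)}{\Gamma(a)\,\Gamma(b)}\left(\frac{\sin \pi a+\sin \pi b}{\sin \pi a\,\sin \pi b}\right),$$ where, at values of $a,b$ for which the right-hand side is formally indeterminate ($a$, $b$ or $a+b$ a non-positive integer), it is understood as its limiting value (continuous extension).
   Context: $\zeta$ is the Riemann zeta function (analytically continued), and $(a)_j=a(a+1)\cdots(a+j-1)$ is the Pochhammer symbol with $(a)_0=1$ (in particular $(0)_0=1$). When $a=-m$ with $m=0,1,2,\ldots$, the product $(a)_j\,\zeta(a+j)$ is understood by its limiting value: for $j=m+1$ it equals $(-1)^m m!$, and for $j\ge m+2$ it equals $0$; likewise for $(b)_k\,\zeta(b+k)$ when $b$ is a non-positive integer. The right-hand side also equals $\Gamma(a+b-1)\,\zeta(a+b-1)\left\{\Gamma(1-a)/\Gamma(b)+\Gamma(1-b)/\Gamma(a)\right\}$ wherever both expressions are defined. *)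

theory Defs
  imports "HOL-Complex_Analysis.Complex_Analysis"
begin

(* The Riemann zeta function: the analytic continuation of its Dirichlet series to the plane
   without the pole 1. The clause at 1 only makes the description unique. *)
definition zeta :: "complex \<Rightarrow> complex" where
  "zeta = (THE f. f holomorphic_on (- {1}) \<and>
                  (\<forall>s. Re s > 1 \<longrightarrow> (\<lambda>n. 1 / of_nat (Suc n) powr s) sums f s) \<and>
                  f 1 = 0)"

(* (a)_j zeta(a + j), with its limiting value (-1)^m m! when a = -m and j = m + 1, where the simple
   zero of the Pochhammer symbol cancels the pole of zeta. For a = -m and j >= m + 2 the product is
   already 0. For a = 1 and j = 0 there is no limiting value, and the value below is arbitrary. *)
definition pochhammer_zeta :: "complex \<Rightarrow> nat \<Rightarrow> complex" where
  "pochhammer_zeta a j =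
     (if a + of_nat j = 1 then (-1) ^ (j - 1) * fact (j - 1)
      else pochhammer a j * zeta (a + of_nat j))"

definition double_term :: "complex \<Rightarrow> complex \<Rightarrow> nat \<Rightarrow> nat \<Rightarrow> complex" where
  "double_term a b j k =
     pochhammer_zeta a j * pochhammer_zeta b k / (fact j * fact k * of_nat (j + k + 1))"

definition closed_form :: "complex \<Rightarrow> complex \<Rightarrow> complex" where
  "closed_form a b =
     of_real pi * Gamma (a + b - 1) * zeta (a + b - 1) / (Gamma a * Gamma b) *
     ((sin (of_real pi * a) + sin (of_real pi * b)) / (sin (of_real pi * a) * sin (of_real pi * b)))"

definition domain_ab :: "(complex \<times> complex) set" where
  "domain_ab = {(a, b). Re a < 1 \<and> Re b < 1 \<and> Re (a + b) < 1}"

(* The points of the domain where every factor of closed_form is defined and no denominator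
   vanishes. This set is dense in the domain, so limits within it are unique. *)
definition regular_ab :: "(complex \<times> complex) set" where
  "regular_ab = {(a, b) \<in> domain_ab. a \<notin> \<int>\<^sub>\<le>\<^sub>0 \<and> b \<notin> \<int>\<^sub>\<le>\<^sub>0 \<and> a + b \<notin> \<int>\<^sub>\<le>\<^sub>0}"

end

theory Submission
  imports Defs "HOL-Real_Asymp.Real_Asymp"
begin

text \<open>
  For real \<open>a, b > 0\<close> with \<open>a + b < 1\<close> every term is a Mellin integral:
  \<open>\<Gamma>(a) (a)\<^sub>j \<zeta>(a + j) / j! = \<integral> t\<^sup>a\<^sup>-\<^sup>1 A\<^sub>j(t) dt\<close> over \<open>(0, \<infinity>)\<close>, where
  \<open>A\<^sub>j(t) = t\<^sup>j / (j! (e\<^sup>t - 1))\<close>, minus \<open>1 / t\<close> when \<open>j = 0\<close>. By the binomial theorem the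
  sum of \<open>A\<^sub>j(t) A\<^sub>k(u) / (j + k + 1)\<close> over all \<open>j, k\<close> collapses to \<open>(h(t) + h(u)) / (t + u)\<close> with
  \<open>h(t) = 1 / (e\<^sup>t - 1) - 1 / t + 1 / 2\<close>. Integrating first over the variable that does not
  occur in \<open>h\<close> gives \<open>\<integral> u\<^sup>b\<^sup>-\<^sup>1 / (t + u) du = \<Gamma>(b) \<Gamma>(1 - b) t\<^sup>b\<^sup>-\<^sup>1\<close>, and then the Mellin
  transform of \<open>h\<close> at \<open>s = a + b - 1\<close> is \<open>\<Gamma>(s) \<zeta>(s)\<close>. Since \<open>(a)\<^sub>j / j!\<close> is of size
  \<open>j\<^sup>a\<^sup>-\<^sup>1\<close>, the double series converges absolutely and locally uniformly on the whole
  domain, so the identity theorem, applied in each variable, extends the identity, and continuity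
  of the sum gives the limiting values.
\<close>

subsection \<open>Mellin integrals of powers\<close>

text \<open>Since \<open>zeta\<close> is a definite description, a function satisfying it has to be
  constructed. The same real Mellin integrals do this: Riemann's formula for them makes sense for
  complex \<open>s\<close>, and division by Gamma gives the continuation. Integrals are evaluated
  only at real parameters; the rest is the identity theorem. Write B(t) = 1 / (e^t - 1). The
  constant 1/2 in h comes from sharing the 1 in B(t) B(u) (e^(t + u) - 1) = B(t) + B(u) + 1 evenly
  between t and u. As h(t) is of order t at 0 and tends to 1/2 at infinity, its Mellin integral
  converges exactly for -1 < s < 0, and a, b > 0 with a + b < 1 put s = a + b - 1 there. The
  obstacle is the exchange of sum and double integral. Each A_j has constant sign on the positive
  axis, so the L^1 norm of a term is the absolute value of the corresponding term of the numerical
  series. The absolute convergence needed for the continuation therefore also justifies the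
  exchange. Gamma(a + b - 1) has poles inside the domain. The identity is continued after
  multiplication by 1 / Gamma(a + b - 1), which makes both sides holomorphic.\<close>

lemma has_bochner_integral_lborel_nonneg:
  fixes f :: "real \<Rightarrow> real"
  assumes "f \<in> borel_measurable borel" "\<And>x. x \<in> S \<Longrightarrow> 0 \<le> f x"
    "(f has_integral I) S" "S \<in> sets borel"
  shows "has_bochner_integral lborel (\<lambda>x. indicator S x * f x) I"
proof (rule has_bochner_integral_nn_integral)
  show "(\<integral>\<^sup>+x. ennreal (indicator S x * f x) \<partial>lborel) = ennreal I"
    using nn_integral_has_integral_lebesgue[OF assms(2,3)] by simp
  show "0 \<le> I"
    using assms(2,3) by (rule has_integral_nonneg[rotated])
qed (use assms(1,2,4) in \<open>auto simp: indicator_def\<close>)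

text \<open>Extending \<open>t powr (s - 1)\<close> by 0 turns integrals over the positive axis into
  integrals over \<open>lborel\<close>, and lets the product rules below hold for every real
  \<open>t\<close>.\<close>

definition mpow :: "real \<Rightarrow> real \<Rightarrow> real" where
  "mpow s t = (if t > 0 then t powr (s - 1) else 0)"

lemma mpow_measurable [measurable]: "mpow s \<in> borel_measurable borel"
  unfolding mpow_def by measurable

lemma mpow_nonneg [simp]: "0 \<le> mpow s t"
  by (simp add: mpow_def)

lemma mpow_mult_power: "mpow s t * t ^ n = mpow (s + real n) t"
  by (simp add: mpow_def algebra_simps flip: powr_add powr_realpow)

lemma mpow_divide: "mpow s t / t = mpow (s - 1) t"
  by (simp add: mpow_def powr_diff power2_eq_square)

lemma mpow_mult_mpow: "mpow s t * mpow r t = mpow (s + r - 1) t"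
  by (simp add: mpow_def flip: powr_add)

lemma has_bochner_integral_mpow_exp:
  assumes "x > 0" "c > 0"
  shows "has_bochner_integral lborel (\<lambda>t. mpow x t * exp (- (c * t))) (Gamma x * c powr - x)"
proof -
  have "has_bochner_integral lborel (\<lambda>t. indicator {0..} t * (t powr (x - 1) / exp t)) (Gamma x)"
    by (rule has_bochner_integral_lborel_nonneg[OF _ _ Gamma_integral_real])
       (use assms in auto)
  hence "has_bochner_integral lborel
      (\<lambda>t. indicator {0..} (0 + c * t) * ((0 + c * t) powr (x - 1) / exp (0 + c * t))) (Gamma x /\<^sub>R \<bar>c\<bar>)"
    using assms by (subst (asm) lborel_has_bochner_integral_real_affine_iff[where c=c and t=0]) auto
  \<comment> \<open>The factor \<open>c powr (1 - x)\<close> undoes the power of \<open>c\<close>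
    that the substitution brings into the integrand.\<close>
  hence "has_bochner_integral lborel (\<lambda>t. c powr (1 - x) * (indicator {0..} (c * t) *
      ((c * t) powr (x - 1) / exp (c * t)))) (c powr (1 - x) * (Gamma x /\<^sub>R \<bar>c\<bar>))"
    by (intro has_bochner_integral_mult_right) simp
  also have "(\<lambda>t. c powr (1 - x) * (indicator {0..} (c * t) * ((c * t) powr (x - 1) / exp (c * t))))
      = (\<lambda>t. mpow x t * exp (- (c * t)))"
  proof
    fix t
    have "c powr (1 - x) * ((c * t) powr (x - 1)) = t powr (x - 1)" if "t > 0"
      using assms that by (simp add: powr_mult flip: powr_add mult.assoc)
    moreover have "c * t \<ge> 0 \<longleftrightarrow> t \<ge> 0"
      using assms by (simp add: zero_le_mult_iff)
    ultimately show "c powr (1 - x) * (indicator {0..} (c * t) * ((c * t) powr (x - 1) / exp (c * t)))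
        = mpow x t * exp (- (c * t))"
      by (auto simp: mpow_def indicator_def exp_minus field_simps)
  qed
  also have "c powr (1 - x) * (Gamma x /\<^sub>R \<bar>c\<bar>) = Gamma x * c powr - x"
    using assms by (simp add: powr_diff powr_minus field_simps)
  finally show ?thesis .
qed

lemma has_bochner_integral_mpow_le_1:
  assumes "p > 0"
  shows "has_bochner_integral lborel (\<lambda>t. indicator {..1} t * mpow p t) (1 / p)"
proof -
  have "has_bochner_integral lborel (\<lambda>t. indicator {0..1} t * t powr (p - 1)) (1 / p)"
    by (rule has_bochner_integral_lborel_nonneg)
       (use assms has_integral_powr_from_0[of "p - 1" 1] in auto)
  thus ?thesis
    by (rule has_bochner_integral_cong[THEN iffD1, rotated 3]) (auto simp: mpow_def indicator_def)
qed

lemma has_bochner_integral_mpow_gt_1: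
  assumes "p < 0"
  shows "has_bochner_integral lborel (\<lambda>t. indicator {1<..} t * mpow p t) (- (1 / p))"
proof -
  have "has_bochner_integral lborel (\<lambda>t. indicator {1..} t * mpow p t) (- (1 / p))"
  proof (rule has_bochner_integral_lborel_nonneg)
    have "((\<lambda>x. x powr (p - 1)) has_integral - (1 / p)) {1..}"
      using assms has_integral_powr_to_inf[of "p - 1" 1] by simp
    thus "(mpow p has_integral - (1 / p)) {1..}"
      by (rule has_integral_eq[rotated]) (auto simp: mpow_def)
  qed auto
  \<comment> \<open>The point 1 is a null set; dropping it makes \<open>{..1}\<close> and
    \<open>{1<..}\<close> a partition of the line.\<close>
  thus ?thesis
    by (rule has_bochner_integral_cong_AE[THEN iffD1, rotated 3])
       (use AE_lborel_singleton[of 1] in \<open>auto simp: indicator_def\<close>)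
qed

lemma geometric_sums_exp:
  assumes "t > (0::real)"
  shows "(\<lambda>n. exp (- (real (Suc n) * t))) sums (1 / (exp t - 1))"
proof -
  have "(\<lambda>n. exp (- t) * exp (- t) ^ n) sums (exp (- t) * (1 / (1 - exp (- t))))"
    by (intro sums_mult geometric_sums) (use assms in auto)
  also have "exp (- t) * (1 / (1 - exp (- t))) = 1 / (exp t - 1)"
    using assms by (simp add: exp_minus field_simps)
  also have "(\<lambda>n. exp (- t) * exp (- t) ^ n) = (\<lambda>n. exp (- (real (Suc n) * t)))"
    by (simp add: exp_of_nat_mult[symmetric] algebra_simps flip: exp_add)
  finally show ?thesis .
qed

section \<open>Termwise integration of series\<close>

lemma has_bochner_integral_sums_nonneg:
  fixes f :: "nat \<Rightarrow> 'a \<Rightarrow> real"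
  assumes int: "\<And>n. has_bochner_integral M (f n) (I n)"
    and nonneg: "\<And>n x. x \<in> space M \<Longrightarrow> 0 \<le> f n x"
    and sums: "\<And>x. x \<in> space M \<Longrightarrow> (\<lambda>n. f n x) sums F x"
    and I: "I sums S"
  shows "has_bochner_integral M F S"
proof -
  have *: "integral\<^sup>L M (f n) = I n" "integrable M (f n)" for n
    using int by (simp_all add: has_bochner_integral_iff)
  have nm: "(\<integral>x. \<bar>f n x\<bar> \<partial>M) = I n" for n
    using nonneg by (subst *(1)[symmetric], intro Bochner_Integration.integral_cong) auto
  have ae: "AE x in M. summable (\<lambda>n. norm (f n x))"
  proof (rule AE_I2)
    fix x assume x: "x \<in> space M"
    have "summable (\<lambda>n. f n x)" using sums[OF x] by (simp add: sums_iff)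
    thus "summable (\<lambda>n. norm (f n x))" using nonneg[OF x] by simp
  qed
  have sI: "summable (\<lambda>n. \<integral>x. norm (f n x) \<partial>M)"
    using I by (simp add: nm sums_iff)
  have "has_bochner_integral M (\<lambda>x. \<Sum>n. f n x) S"
    using integrable_suminf[OF *(2) ae sI] integral_suminf[OF *(2) ae sI] I
    by (simp add: has_bochner_integral_iff * sums_iff)
  thus ?thesis
    by (rule has_bochner_integral_cong[THEN iffD1, rotated 3]) (use sums in \<open>auto simp: sums_iff\<close>)
qed

lemma has_bochner_integral_sums_abs:
  fixes f :: "nat \<Rightarrow> 'a \<Rightarrow> real"
  assumes int: "\<And>n. has_bochner_integral M (f n) (I n)"
    and sums: "\<And>x. x \<in> space M \<Longrightarrow> (\<lambda>n. f n x) sums F x"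
    and abs: "\<And>x. x \<in> space M \<Longrightarrow> summable (\<lambda>n. \<bar>f n x\<bar>)"
    and J: "\<And>n. (\<integral>x. \<bar>f n x\<bar> \<partial>M) \<le> J n" "summable J"
  shows "has_bochner_integral M F (\<Sum>n. I n)"
proof -
  have *: "integral\<^sup>L M (f n) = I n" "integrable M (f n)" for n
    using int by (simp_all add: has_bochner_integral_iff)
  have ae: "AE x in M. summable (\<lambda>n. norm (f n x))"
    by (rule AE_I2) (use abs in auto)
  have sI: "summable (\<lambda>n. \<integral>x. norm (f n x) \<partial>M)"
    by (rule summable_comparison_test'[OF J(2), of 0]) (use J(1) in auto)
  have "has_bochner_integral M (\<lambda>x. \<Sum>n. f n x) (\<Sum>n. I n)"
    using integrable_suminf[OF *(2) ae sI] integral_suminf[OF *(2) ae sI]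
    by (simp add: has_bochner_integral_iff *)
  thus ?thesis
    by (rule has_bochner_integral_cong[THEN iffD1, rotated 3]) (use sums in \<open>auto simp: sums_iff\<close>)
qed

section \<open>Taylor expansion of t / (e^t - 1)\<close>

definition bgen :: "complex \<Rightarrow> complex" where
  "bgen z = (if z = 0 then 1 else z / (exp z - 1))"

text \<open>The nonzero solutions of e^z = 1 have modulus at least 2 pi, so radius 2 is safe. What
  matters later is a radius above 1, because the series is integrated up to the splitting point t =
  1.\<close>

lemma bgen_holomorphic: "bgen holomorphic_on ball 0 2"
proof (rule no_isolated_singularity'[where K="{0}"])
  have nz: "exp z \<noteq> 1" if "z \<in> ball 0 2 - {0}" for z :: complex
  proof
    assume "exp z = 1"
    then obtain n :: int where z: "Re z = 0" "Im z = of_int (2 * n) * pi"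
      by (auto simp: exp_eq_1)
    have "\<bar>Im z\<bar> < 2"
      using that abs_Im_le_cmod[of z] by auto
    hence "\<bar>of_int n\<bar> * pi < 1"
      using z pi_gt3 by (simp add: abs_mult)
    moreover have "\<bar>of_int n :: real\<bar> * 1 \<le> \<bar>of_int n\<bar> * pi"
      using pi_gt3 by (intro mult_left_mono) auto
    ultimately have "\<bar>of_int n :: real\<bar> < 1" by linarith
    hence "n = 0" by linarith
    thus False using z that by (simp add: complex_eq_iff)
  qed
  have "(\<lambda>z. z / (exp z - 1)) holomorphic_on ball 0 2 - {0}"
    by (intro holomorphic_intros) (use nz in auto)
  thus "bgen holomorphic_on ball 0 2 - {0}"
    by (rule holomorphic_transform) (auto simp: bgen_def)
  have "((\<lambda>z::complex. inverse ((exp z - 1) / z)) \<longlongrightarrow> inverse 1) (at 0 within ball 0 2)"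
    by (intro tendsto_intros filterlim_mono[OF lim_exp_minus_1 order.refl]) (auto simp: at_le)
  hence "((\<lambda>z::complex. inverse ((exp z - 1) / z)) \<longlongrightarrow> 1) (at 0 within ball 0 2)"
    by simp
  hence "(bgen \<longlongrightarrow> 1) (at 0 within ball 0 2)"
    by (rule Lim_transform_eventually)
       (auto simp: bgen_def eventually_at_filter)
  thus "(bgen \<longlongrightarrow> bgen z) (at z within ball 0 2)" if "z \<in> {0}" for z
    using that by (simp add: bgen_def)
qed auto

text \<open>The Bernoulli numbers divided by \<open>n!\<close>, as Taylor coefficients of \<open>t / (e\<^sup>t - 1)\<close>.\<close>

definition bcoeff :: "nat \<Rightarrow> real" where
  "bcoeff n = Re ((deriv ^^ n) bgen 0 / fact n)"

lemma bcoeff_sums: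
  assumes "\<bar>t\<bar> < 2" "t \<noteq> 0"
  shows "(\<lambda>n. bcoeff n * t ^ n) sums (t / (exp t - 1))"
proof -
  have "(\<lambda>n. (deriv ^^ n) bgen 0 / fact n * (of_real t - 0) ^ n) sums bgen (of_real t)"
    by (rule holomorphic_power_series[OF bgen_holomorphic]) (use assms in auto)
  hence "(\<lambda>n. Re ((deriv ^^ n) bgen 0 / fact n * of_real (t ^ n))) sums Re (bgen (of_real t))"
    by (intro sums_Re) simp
  also have "bgen (of_real t) = of_real (t / (exp t - 1))"
    using assms by (simp add: bgen_def flip: exp_of_real)
  finally show ?thesis
    by (simp add: bcoeff_def mult.commute[of _ "complex_of_real _"] flip: times_divide_eq_right
             del: of_real_power) (simp add: mult.commute del: of_real_power)
qed

lemma bcoeff_summable: "summable (\<lambda>n. \<bar>bcoeff n\<bar>)"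
proof -
  have "summable (\<lambda>n. norm (bcoeff n * 1 ^ n))"
    \<comment> \<open>The point 3/2 lies between 1 and the radius 2: convergence there gives
      absolute convergence at 1.\<close>
    by (rule powser_insidea[where x="3/2"]) (use bcoeff_sums[of "3/2"] in \<open>auto simp: sums_iff\<close>)
  thus ?thesis by simp
qed

lemma bcoeff_0: "bcoeff 0 = 1"
proof -
  have "((\<lambda>t::real. t / (exp t - 1)) \<longlongrightarrow> bcoeff 0) (at 0)"
    by (rule powser_limit_0_strong[where s=2]) (use bcoeff_sums in auto)
  moreover have "((\<lambda>t::real. t / (exp t - 1)) \<longlongrightarrow> 1) (at 0)"
    using tendsto_inverse[OF lim_exp_minus_1[where 'a=real]] by simp
  ultimately show ?thesis
    using tendsto_unique[of "at (0::real)"] by auto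
qed

lemma bcoeff_1: "bcoeff 1 = - (1 / 2)"
proof -
  have "((\<lambda>t::real. (t / (exp t - 1) - 1) / t) \<longlongrightarrow> bcoeff (Suc 0)) (at 0)"
  proof (rule powser_limit_0_strong[where s=2 and a="\<lambda>n. bcoeff (Suc n)"])
    fix t :: real assume t: "t \<noteq> 0" "norm t < 2"
    have "(\<lambda>n. bcoeff (Suc n) * t ^ Suc n) sums (t / (exp t - 1) - 1)"
      using bcoeff_sums[of t] t by (subst sums_Suc_iff) (auto simp: bcoeff_0)
    hence "(\<lambda>n. bcoeff (Suc n) * t ^ Suc n / t) sums ((t / (exp t - 1) - 1) / t)"
      by (rule sums_divide)
    thus "(\<lambda>n. bcoeff (Suc n) * t ^ n) sums ((t / (exp t - 1) - 1) / t)"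
      using t by simp
  qed auto
  hence "((\<lambda>t::real. (t / (exp t - 1) - 1) / t) \<longlongrightarrow> bcoeff (Suc 0)) (at_right 0)"
    by (rule filterlim_mono) (auto simp: at_le)
  moreover have "((\<lambda>t::real. (t / (exp t - 1) - 1) / t) \<longlongrightarrow> - (1 / 2)) (at_right 0)"
    by real_asymp
  ultimately show ?thesis
    using tendsto_unique[of "at_right (0::real)"] by auto
qed

subsection \<open>The Mellin transform of the Bose function\<close>

definition bose :: "real \<Rightarrow> real" where
  "bose t = 1 / (exp t - 1)"

lemma bose_measurable [measurable]: "bose \<in> borel_measurable borel"
  unfolding bose_def by measurable

lemma bose_nonneg: "t > 0 \<Longrightarrow> 0 \<le> bose t"
  by (simp add: bose_def)

lemma integrable_mpow_bose_gt_1: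
  "integrable lborel (\<lambda>t. indicator {1<..} t * (mpow s t * bose t))"
proof (rule Bochner_Integration.integrable_bound)
  \<comment> \<open>\<open>max s 1\<close> keeps the Gamma integral convergent for every real
    \<open>s\<close>; for t > 1 raising the exponent only enlarges the integrand.\<close>
  show "integrable lborel (\<lambda>t. 2 * (mpow (max s 1) t * exp (- (1 * t))))"
    by (intro integrable_mult_right has_bochner_integral_mpow_exp[THEN has_bochner_integral_iff[THEN iffD1], THEN conjunct1]) auto
  have "indicator {1<..} t * (mpow s t * bose t) \<le> 2 * (mpow (max s 1) t * exp (- (1 * t)))" for t
  proof (cases "t > 1")
    case True
    have "mpow s t \<le> mpow (max s 1) t"
      using True by (simp add: mpow_def)
    moreover have "bose t \<le> 2 * exp (- t)"
    proof -
      have "2 \<le> exp t"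
        using exp_ge_add_one_self[of t] True by linarith
      hence "exp t / 2 \<le> exp t - 1" by simp
      hence "1 / (exp t - 1) \<le> 1 / (exp t / 2)"
        by (rule divide_left_mono) (use True in auto)
      thus ?thesis by (simp add: bose_def exp_minus field_simps)
    qed
    ultimately have "mpow s t * bose t \<le> mpow (max s 1) t * (2 * exp (- t))"
      using True by (intro mult_mono) (auto simp: bose_nonneg)
    thus ?thesis using True by simp
  qed auto
  moreover have "0 \<le> indicator {1<..} t * (mpow s t * bose t)" for t
    by (auto simp: indicator_def bose_nonneg)
  ultimately show "AE t in lborel. norm (indicator {1<..} t * (mpow s t * bose t))
      \<le> norm (2 * (mpow (max s 1) t * exp (- (1 * t))))"
    by (intro AE_I2) (simp add: abs_of_nonneg)
qed auto

text \<open>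
  Expanding \<open>t\<^sup>s\<close> in powers of \<open>s\<close> shows that the part of the Mellin integral over
  \<open>(1, \<infinity>)\<close> is an entire power series in \<open>s\<close>.
\<close>

definition log_bose :: "nat \<Rightarrow> real \<Rightarrow> real" where
  "log_bose k t = indicator {1<..} t * (mpow 0 t * bose t) * (ln t ^ k / fact k)"

definition ecoeff :: "nat \<Rightarrow> real" where
  "ecoeff k = (LINT t|lborel. log_bose k t)"

lemma log_bose_measurable [measurable]: "log_bose k \<in> borel_measurable borel"
  unfolding log_bose_def by measurable

lemma log_bose_nonneg: "0 \<le> log_bose k t"
  by (auto simp: log_bose_def indicator_def bose_nonneg)

lemma log_bose_sums: "(\<lambda>k. s ^ k * log_bose k t) sums (indicator {1<..} t * (mpow s t * bose t))"
proof (cases "t > 1")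
  case True
  have "(\<lambda>k. (s * ln t) ^ k /\<^sub>R fact k) sums exp (s * ln t)"
    by (rule exp_converges)
  hence "(\<lambda>k. mpow 0 t * bose t * ((s * ln t) ^ k /\<^sub>R fact k)) sums
          (mpow 0 t * bose t * exp (s * ln t))"
    by (rule sums_mult)
  moreover have "mpow 0 t * bose t * exp (s * ln t) = mpow s t * bose t"
  proof -
    have "mpow 0 t * exp (s * ln t) = mpow s t"
      using True by (simp add: mpow_def powr_def algebra_simps flip: exp_add)
    thus ?thesis by (metis mult.assoc mult.commute)
  qed
  ultimately show ?thesis
    using True by (simp only:) (simp add: log_bose_def power_mult_distrib divide_inverse mult_ac)
next
  case False
  thus ?thesis by (simp add: log_bose_def)
qed

lemma log_bose_integrable: "integrable lborel (log_bose k)"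
proof (rule Bochner_Integration.integrable_bound[OF integrable_mpow_bose_gt_1[of 1]])
  show "AE t in lborel. norm (log_bose k t) \<le> norm (indicator {1<..} t * (mpow 1 t * bose t))"
  proof (rule AE_I2)
    fix t
    have s: "(\<lambda>k. log_bose k t) sums (indicator {1<..} t * (mpow 1 t * bose t))"
      using log_bose_sums[of 1 t] by simp
    hence "log_bose k t \<le> indicator {1<..} t * (mpow 1 t * bose t)"
      using sum_le_suminf[of "\<lambda>k. log_bose k t" "{k}"] by (auto simp: sums_iff log_bose_nonneg)
    thus "norm (log_bose k t) \<le> norm (indicator {1<..} t * (mpow 1 t * bose t))"
      using log_bose_nonneg[of k t] by simp
  qed
qed auto

lemma ecoeff_nonneg: "0 \<le> ecoeff k"
  unfolding ecoeff_def by (intro Bochner_Integration.integral_nonneg log_bose_nonneg)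

text \<open>For \<open>s \<ge> 0\<close> all terms are nonnegative, so the partial sums stay below
  the full integral over t > 1. Applied to |s|, this gives absolute convergence for every real or
  complex \<open>s\<close>.\<close>

lemma ecoeff_summable_nonneg:
  assumes "s \<ge> 0"
  shows "summable (\<lambda>k. s ^ k * ecoeff k)"
proof (rule summableI_nonneg_bounded)
  fix n
  have "(\<Sum>k<n. s ^ k * ecoeff k) = (LINT t|lborel. (\<Sum>k<n. s ^ k * log_bose k t))"
    using log_bose_integrable by (simp add: ecoeff_def)
  also have "\<dots> \<le> (LINT t|lborel. indicator {1<..} t * (mpow s t * bose t))"
  proof (rule integral_mono)
    show "integrable lborel (\<lambda>t. \<Sum>k<n. s ^ k * log_bose k t)"
      using log_bose_integrable by auto
    show "(\<Sum>k<n. s ^ k * log_bose k t) \<le> indicator {1<..} t * (mpow s t * bose t)" for t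
      using sum_le_suminf[of "\<lambda>k. s ^ k * log_bose k t" "{..<n}"] log_bose_sums[of s t] assms
      by (auto simp: sums_iff log_bose_nonneg)
  qed (rule integrable_mpow_bose_gt_1)
  finally show "(\<Sum>k<n. s ^ k * ecoeff k) \<le> (LINT t|lborel. indicator {1<..} t * (mpow s t * bose t))" .
qed (use assms ecoeff_nonneg in auto)

lemma has_bochner_integral_mpow_bose_gt_1:
  "has_bochner_integral lborel (\<lambda>t. indicator {1<..} t * (mpow s t * bose t)) (\<Sum>k. s ^ k * ecoeff k)"
proof (rule has_bochner_integral_sums_abs[OF _ log_bose_sums])
  show "has_bochner_integral lborel (\<lambda>t. s ^ n * log_bose n t) (s ^ n * ecoeff n)" for n
    using log_bose_integrable by (intro has_bochner_integral_mult_right)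
      (simp add: has_bochner_integral_iff ecoeff_def)
  show "summable (\<lambda>n. \<bar>s ^ n * log_bose n t\<bar>)" for t
    using log_bose_sums[of "\<bar>s\<bar>" t] by (simp add: abs_mult power_abs log_bose_nonneg sums_iff)
  show "(LINT t|lborel. \<bar>s ^ n * log_bose n t\<bar>) \<le> \<bar>s\<bar> ^ n * ecoeff n" for n
    by (simp add: abs_mult power_abs log_bose_nonneg ecoeff_def)
qed (rule ecoeff_summable_nonneg, simp)

text \<open>Removing the first \<open>k\<close> terms of the Laurent series of \<open>bose\<close>
  at 0 moves the strip of convergence of the Mellin integral to the left. The cases used are k = 0,
  1 and 2; k = 2 gives the function h of the overview.\<close>

definition bose_tail :: "nat \<Rightarrow> real \<Rightarrow> real" where
  "bose_tail k t = bose t - (\<Sum>n<k. bcoeff n * t ^ n) / t"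

lemma bose_tail_measurable [measurable]: "bose_tail k \<in> borel_measurable borel"
  unfolding bose_tail_def by measurable

text \<open>
  Riemann's splitting at \<open>t = 1\<close>: the Taylor series integrated over \<open>(0, 1]\<close> gives the poles,
  and the formula is the same in every strip, although the subtracted part of the integrand is not.
\<close>

definition mellin_bose :: "real \<Rightarrow> real" where
  "mellin_bose s = (\<Sum>n. bcoeff n / (s + real n - 1)) + (\<Sum>k. s ^ k * ecoeff k)"

text \<open>Termwise integration of t^(s + n - 2) over (0, 1]. Since s + k > 1, all denominators are
  at least s + k - 1 > 0, so the absolute sum of the \<open>bcoeff\<close> provides the
  majorant.\<close>

lemma has_bochner_integral_mpow_bose_tail_le_1:
  assumes "s + real k > 1"
  shows "has_bochner_integral lborel (\<lambda>t. indicator {..1} t * (mpow s t * bose_tail k t))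
    (\<Sum>n. bcoeff (n + k) / (s + real (n + k) - 1))"
proof (rule has_bochner_integral_sums_abs[where f="\<lambda>n t. bcoeff (n + k) * (indicator {..1} t * mpow (s + real (n + k) - 1) t)"
     and J="\<lambda>n. \<bar>bcoeff (n + k)\<bar> * (1 / (s + real k - 1))"])
  have *: "has_bochner_integral lborel (\<lambda>t. indicator {..1} t * mpow (s + real (n + k) - 1) t)
      (1 / (s + real (n + k) - 1))" for n
    by (rule has_bochner_integral_mpow_le_1) (use assms in auto)
  show "has_bochner_integral lborel
      (\<lambda>t. bcoeff (n + k) * (indicator {..1} t * mpow (s + real (n + k) - 1) t))
      (bcoeff (n + k) / (s + real (n + k) - 1))" for n
    using has_bochner_integral_mult_right[OF *, of "bcoeff (n + k)"] by simp
  have eq: "mpow (s + real (n + k) - 1) t = mpow s t / t * t ^ (n + k)" for n t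
  proof -
    have "mpow s t / t * t ^ (n + k) = mpow (s - 1 + real (n + k)) t"
      by (simp only: mpow_divide mpow_mult_power)
    thus ?thesis by (simp add: algebra_simps)
  qed
  show "(\<lambda>n. bcoeff (n + k) * (indicator {..1} t * mpow (s + real (n + k) - 1) t)) sums
      (indicator {..1} t * (mpow s t * bose_tail k t))" for t
  proof (cases "0 < t \<and> t \<le> 1")
    case True
    have "(\<lambda>n. bcoeff (n + k) * t ^ (n + k)) sums (t / (exp t - 1) - (\<Sum>n<k. bcoeff n * t ^ n))"
      using bcoeff_sums[of t] True by (intro sums_split_initial_segment) auto
    hence "(\<lambda>n. mpow s t / t * (bcoeff (n + k) * t ^ (n + k))) sums
        (mpow s t / t * (t / (exp t - 1) - (\<Sum>n<k. bcoeff n * t ^ n)))"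
      by (rule sums_mult)
    moreover have "mpow s t / t * (t / (exp t - 1) - (\<Sum>n<k. bcoeff n * t ^ n))
        = mpow s t * bose_tail k t"
      using True by (simp add: bose_tail_def bose_def field_simps)
    ultimately show ?thesis
      using True unfolding eq by (simp add: mult_ac)
  qed (auto simp: mpow_def)
  show "summable (\<lambda>n. \<bar>bcoeff (n + k) * (indicator {..1} t * mpow (s + real (n + k) - 1) t)\<bar>)" for t
  proof (cases "0 < t \<and> t \<le> 1")
    case True
    show ?thesis
    proof (rule summable_comparison_test'[where N=0])
      show "summable (\<lambda>n. \<bar>bcoeff (n + k)\<bar> * (mpow s t / t))"
        by (intro summable_mult2 summable_ignore_initial_segment bcoeff_summable)
      show "norm \<bar>bcoeff (n + k) * (indicator {..1} t * mpow (s + real (n + k) - 1) t)\<bar>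
          \<le> \<bar>bcoeff (n + k)\<bar> * (mpow s t / t)" for n
      proof -
        have "t ^ (n + k) \<le> 1" using True by (intro power_le_one) auto
        hence "mpow s t / t * t ^ (n + k) \<le> mpow s t / t * 1"
          using True by (intro mult_left_mono) auto
        thus ?thesis
          using True mult_left_mono[of "mpow s t / t * t ^ (n + k)" "mpow s t / t" "\<bar>bcoeff (n + k)\<bar>"]
          unfolding eq by (simp add: abs_mult)
      qed
    qed
  qed (auto simp: mpow_def)
  show "(LINT t|lborel. \<bar>bcoeff (n + k) * (indicator {..1} t * mpow (s + real (n + k) - 1) t)\<bar>)
      \<le> \<bar>bcoeff (n + k)\<bar> * (1 / (s + real k - 1))" for n
  proof -
    have "(LINT t|lborel. \<bar>bcoeff (n + k) * (indicator {..1} t * mpow (s + real (n + k) - 1) t)\<bar>)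
       = \<bar>bcoeff (n + k)\<bar> * (1 / (s + real (n + k) - 1))"
      using *[of n] by (simp add: abs_mult has_bochner_integral_iff)
    also have "\<dots> \<le> \<bar>bcoeff (n + k)\<bar> * (1 / (s + real k - 1))"
      using assms by (intro mult_left_mono divide_left_mono) auto
    finally show ?thesis .
  qed
  show "summable (\<lambda>n. \<bar>bcoeff (n + k)\<bar> * (1 / (s + real k - 1)))"
    by (intro summable_mult2 summable_ignore_initial_segment bcoeff_summable)
qed

text \<open>Each subtracted power is integrable over (1, infinity) because s + n < 1, and it
  contributes bcoeff n / (s + n - 1), exactly the term missing from the Taylor sum over (0, 1]. This
  is why the total does not depend on \<open>k\<close>.\<close>

lemma has_bochner_integral_mpow_bose_tail_gt_1:
  assumes "\<And>n. n < k \<Longrightarrow> s + real n < 1"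
  shows "has_bochner_integral lborel (\<lambda>t. indicator {1<..} t * (mpow s t * bose_tail k t))
    ((\<Sum>k. s ^ k * ecoeff k) + (\<Sum>n<k. bcoeff n / (s + real n - 1)))"
proof -
  have "has_bochner_integral lborel (\<lambda>t. indicator {1<..} t * (mpow s t * bose t) -
      (\<Sum>n<k. bcoeff n * (indicator {1<..} t * mpow (s + real n - 1) t)))
     ((\<Sum>k. s ^ k * ecoeff k) - (\<Sum>n<k. bcoeff n * (- (1 / (s + real n - 1)))))"
    using assms by (intro has_bochner_integral_diff has_bochner_integral_mpow_bose_gt_1
      has_bochner_integral_sum has_bochner_integral_mult_right has_bochner_integral_mpow_gt_1) auto
  also have "(\<lambda>t. indicator {1<..} t * (mpow s t * bose t) -
      (\<Sum>n<k. bcoeff n * (indicator {1<..} t * mpow (s + real n - 1) t)))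
     = (\<lambda>t. indicator {1<..} t * (mpow s t * bose_tail k t))"
  proof
    fix t :: real
    have "mpow (s + real n - 1) t = mpow s t / t * t ^ n" for n
    proof -
      have "mpow s t / t * t ^ n = mpow (s - 1 + real n) t"
        by (simp only: mpow_divide mpow_mult_power)
      thus ?thesis by (simp add: algebra_simps)
    qed
    thus "indicator {1<..} t * (mpow s t * bose t) -
      (\<Sum>n<k. bcoeff n * (indicator {1<..} t * mpow (s + real n - 1) t))
     = indicator {1<..} t * (mpow s t * bose_tail k t)"
      by (simp add: bose_tail_def algebra_simps sum_distrib_left sum_divide_distrib)
  qed
  finally show ?thesis by (simp add: sum_negf)
qed

text \<open>The hypotheses describe the half-line s > 1 for k = 0 and the strip 1 - k < s < 2 - k
  for k > 0.\<close>

lemma has_bochner_integral_mellin_bose: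
  assumes "s + real k > 1" "\<And>n. n < k \<Longrightarrow> s + real n < 1"
  shows "has_bochner_integral lborel (\<lambda>t. mpow s t * bose_tail k t) (mellin_bose s)"
proof -
  have "summable (\<lambda>n. bcoeff (n + k) / (s + real (n + k) - 1))"
  proof (rule summable_comparison_test'[where N=0])
    show "summable (\<lambda>n. \<bar>bcoeff (n + k)\<bar> * (1 / (s + real k - 1)))"
      by (intro summable_mult2 summable_ignore_initial_segment bcoeff_summable)
    show "norm (bcoeff (n + k) / (s + real (n + k) - 1)) \<le> \<bar>bcoeff (n + k)\<bar> * (1 / (s + real k - 1))" for n
      using assms(1) by (simp add: abs_mult divide_left_mono)
  qed
  hence "summable (\<lambda>n. bcoeff n / (s + real n - 1))"
    using summable_iff_shift[of "\<lambda>n. bcoeff n / (s + real n - 1)" k] by simp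
  hence "(\<Sum>n. bcoeff n / (s + real n - 1)) = (\<Sum>n. bcoeff (n + k) / (s + real (n + k) - 1)) +
      (\<Sum>n<k. bcoeff n / (s + real n - 1))"
    by (rule suminf_split_initial_segment)
  moreover have "(\<lambda>t. mpow s t * bose_tail k t) = (\<lambda>t. indicator {..1} t * (mpow s t * bose_tail k t)
      + indicator {1<..} t * (mpow s t * bose_tail k t))"
    by (auto simp: indicator_def fun_eq_iff)
  ultimately show ?thesis
    using has_bochner_integral_add[OF has_bochner_integral_mpow_bose_tail_le_1[OF assms(1)] has_bochner_integral_mpow_bose_tail_gt_1[OF assms(2)]]
    by (simp add: mellin_bose_def add_ac)
qed

text \<open>Expand 1 / (e^t - 1) as a geometric series and integrate each exponential by the Gamma
  integral. This is the link between the Mellin transform and the Dirichlet series.\<close>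

lemma mellin_bose_eq_Dirichlet:
  assumes "s > 1"
  shows "mellin_bose s = Gamma s * (\<Sum>n. real (Suc n) powr - s)"
proof -
  have sm: "summable (\<lambda>n. real (Suc n) powr - s)"
    using assms by (subst summable_Suc_iff) (simp add: summable_real_powr_iff)
  have "has_bochner_integral lborel (\<lambda>t. mpow s t * bose_tail 0 t) (Gamma s * (\<Sum>n. real (Suc n) powr - s))"
  proof (rule has_bochner_integral_sums_nonneg)
    show "has_bochner_integral lborel (\<lambda>t. mpow s t * exp (- (real (Suc n) * t))) (Gamma s * real (Suc n) powr - s)" for n
      using assms by (intro has_bochner_integral_mpow_exp) auto
    show "(\<lambda>n. mpow s t * exp (- (real (Suc n) * t))) sums (mpow s t * bose_tail 0 t)" for t
    proof (cases "t > 0")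
      case True
      thus ?thesis
        using sums_mult[OF geometric_sums_exp, of t "mpow s t"] by (simp add: bose_tail_def bose_def)
    qed (auto simp: mpow_def)
    show "(\<lambda>n. Gamma s * real (Suc n) powr - s) sums (Gamma s * (\<Sum>n. real (Suc n) powr - s))"
      using sm by (intro sums_mult summable_sums)
  qed auto
  moreover have "has_bochner_integral lborel (\<lambda>t. mpow s t * bose_tail 0 t) (mellin_bose s)"
    using assms by (intro has_bochner_integral_mellin_bose) auto
  ultimately show ?thesis
    by (rule has_bochner_integral_eq[symmetric])
qed

subsection \<open>Analytic continuation of the zeta function\<close>

lemma holomorphic_suminf:
  fixes f :: "nat \<Rightarrow> complex \<Rightarrow> complex"
  assumes "open S" and hol: "\<And>n. f n holomorphic_on S"
    and bound: "\<And>x. x \<in> S \<Longrightarrow> \<exists>d>0. \<exists>M. summable M \<and> (\<forall>y\<in>cball x d \<inter> S. \<forall>n. norm (f n y) \<le> M n)"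
  shows "(\<lambda>x. \<Sum>n. f n x) holomorphic_on S"
proof (rule holomorphic_uniform_sequence[where f="\<lambda>n x. \<Sum>i<n. f i x"])
  fix x assume x: "x \<in> S"
  obtain d M where d: "d > 0" "summable M" "\<And>y n. y \<in> cball x d \<inter> S \<Longrightarrow> norm (f n y) \<le> M n"
    using bound[OF x] by metis
  obtain e where e: "e > 0" "cball x e \<subseteq> S"
    using x \<open>open S\<close> open_contains_cball_eq by blast
  have "uniform_limit (cball x (min d e)) (\<lambda>n x. \<Sum>i<n. f i x) (\<lambda>x. \<Sum>n. f n x) sequentially"
    by (rule Weierstrass_m_test[where M=M]) (use d e in auto)
  thus "\<exists>d>0. cball x d \<subseteq> S \<and> uniform_limit (cball x d) (\<lambda>n x. \<Sum>i<n. f i x) (\<lambda>x. \<Sum>n. f n x) sequentially"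
    using d e by (intro exI[of _ "min d e"]) auto
qed (use assms in \<open>auto intro!: holomorphic_intros\<close>)

section \<open>The Dirichlet series in the half-plane Re s > 1\<close>

lemma norm_inverse_nat_powr: "norm (1 / of_nat (Suc n) powr s :: complex) = real (Suc n) powr - Re s"
proof -
  have "norm (of_nat (Suc n) powr s :: complex) = real (Suc n) powr Re s"
    by (subst norm_powr_real_powr) (auto simp: add_nonneg_nonneg)
  thus ?thesis by (simp add: norm_divide powr_minus field_simps)
qed

lemma summable_Dirichlet_real:
  assumes "s > (1::real)" shows "summable (\<lambda>n. real (Suc n) powr - s)"
  using assms by (subst summable_Suc_iff) (simp add: summable_real_powr_iff)

definition dirichlet_zeta :: "complex \<Rightarrow> complex" where
  "dirichlet_zeta s = (\<Sum>n. 1 / of_nat (Suc n) powr s)"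

lemma dirichlet_zeta_sums:
  assumes "Re s > 1"
  shows "(\<lambda>n. 1 / of_nat (Suc n) powr s) sums dirichlet_zeta s"
  unfolding dirichlet_zeta_def
  by (rule summable_sums, rule summable_norm_cancel)
     (use summable_Dirichlet_real[OF assms] in \<open>simp only: norm_inverse_nat_powr\<close>)

lemma dirichlet_zeta_holomorphic: "dirichlet_zeta holomorphic_on {s. Re s > 1}"
proof -
  have "(\<lambda>s. \<Sum>n. 1 / of_nat (Suc n) powr s :: complex) holomorphic_on {s. Re s > 1}"
  proof (rule holomorphic_suminf)
    fix x :: complex assume x: "x \<in> {s. Re s > 1}"
    define d where "d = (Re x - 1) / 2"
    have "norm (1 / of_nat (Suc n) powr y :: complex) \<le> real (Suc n) powr - (1 + d)"
      if "y \<in> cball x d" for y n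
    proof -
      have "\<bar>Re (x - y)\<bar> \<le> d"
        using that abs_Re_le_cmod[of "x - y"] by (simp add: dist_norm)
      hence "Re x - Re y \<le> d" by simp
      hence "1 + d \<le> Re y" by (simp add: d_def field_simps)
      thus ?thesis
        unfolding norm_inverse_nat_powr by (intro powr_mono) auto
    qed
    moreover have "summable (\<lambda>n. real (Suc n) powr - (1 + d))"
      using x by (intro summable_Dirichlet_real) (auto simp: d_def)
    moreover have "d > 0" using x by (simp add: d_def)
    ultimately show "\<exists>d>0. \<exists>M. summable M \<and> (\<forall>y\<in>cball x d \<inter> {s. 1 < Re s}. \<forall>n.
        norm (1 / of_nat (Suc n) powr y :: complex) \<le> M n)"
      by (intro exI[of _ d] exI[of _ "\<lambda>n. real (Suc n) powr - (1 + d)"]) auto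
  qed (auto intro!: holomorphic_intros open_halfspace_Re_gt simp del: of_nat_Suc)
  thus ?thesis by (simp add: dirichlet_zeta_def[abs_def])
qed

section \<open>Poles and residues of the continued Mellin transform\<close>

definition pole_sum :: "nat set \<Rightarrow> complex \<Rightarrow> complex" where
  "pole_sum A s = (\<Sum>n. if n \<in> A then of_real (bcoeff n) / (s + of_nat n - 1) else 0)"

definition pole_set :: "nat set \<Rightarrow> complex set" where
  "pole_set A = (\<lambda>n. 1 - of_nat n) ` A"

lemma closed_pole_set: "closed (pole_set A)"
proof (rule closed_subset_Ints)
  show "pole_set A \<subseteq> \<int>" by (auto simp: pole_set_def)
qed

text \<open>A point within \<open>d\<close> of \<open>x\<close> keeps distance at least
  \<open>d\<close> from every pole when \<open>x\<close> keeps distance above 2 d. All denominators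
  are then bounded below at once.\<close>

lemma norm_pole_sum_term_le:
  assumes "d > 0" "cball x (2 * d) \<inter> pole_set A = {}" "y \<in> cball x d"
  shows "norm (if n \<in> A then of_real (bcoeff n) / (y + of_nat n - 1) else 0 :: complex)
    \<le> \<bar>bcoeff n\<bar> * (1 / d)"
proof (cases "n \<in> A")
  case True
  have "2 * d < dist x (1 - of_nat n)"
    using True assms(2) by (force simp: pole_set_def)
  also have "\<dots> \<le> dist x y + dist y (1 - of_nat n)"
    by (rule dist_triangle)
  finally have "d \<le> norm (y + of_nat n - 1)"
    using assms(3) by (simp add: dist_norm algebra_simps)
  hence "\<bar>bcoeff n\<bar> / norm (y + of_nat n - 1) \<le> \<bar>bcoeff n\<bar> / d"
    using assms(1) by (intro divide_left_mono mult_pos_pos) auto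
  thus ?thesis using True by (simp add: norm_divide)
qed (use assms(1) in auto)

lemma pole_set_avoid:
  assumes "x \<notin> pole_set A"
  obtains d where "d > 0" "cball x (2 * d) \<inter> pole_set A = {}"
proof -
  obtain e where "e > 0" "cball x e \<subseteq> - pole_set A"
    using assms closed_pole_set[of A] by (meson ComplI open_Compl open_contains_cball)
  thus ?thesis by (intro that[of "e / 2"]) auto
qed

lemma pole_sum_holomorphic: "pole_sum A holomorphic_on - pole_set A"
proof -
  have "(\<lambda>s. \<Sum>n. if n \<in> A then of_real (bcoeff n) / (s + of_nat n - 1) else 0 :: complex)
    holomorphic_on - pole_set A"
  proof (rule holomorphic_suminf)
    show "open (- pole_set A)" using closed_pole_set by auto
    fix n
    show "(\<lambda>s. if n \<in> A then of_real (bcoeff n) / (s + of_nat n - 1) else 0 :: complex)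
        holomorphic_on - pole_set A"
    proof (cases "n \<in> A")
      case True
      have "s + of_nat n - 1 \<noteq> 0" if "s \<in> - pole_set A" for s :: complex
      proof
        assume "s + of_nat n - 1 = 0"
        hence "s = 1 - of_nat n" by (simp add: algebra_simps)
        thus False using that True by (auto simp: pole_set_def)
      qed
      thus ?thesis using True by (auto intro!: holomorphic_intros)
    qed auto
  next
    fix x assume x: "x \<in> - pole_set A"
    obtain d where d: "d > 0" "cball x (2 * d) \<inter> pole_set A = {}"
      using x pole_set_avoid by auto
    show "\<exists>d>0. \<exists>M. summable M \<and> (\<forall>y\<in>cball x d \<inter> - pole_set A. \<forall>n.
        norm (if n \<in> A then of_real (bcoeff n) / (y + of_nat n - 1) else 0 :: complex) \<le> M n)"
      using norm_pole_sum_term_le[OF d] summable_mult2[OF bcoeff_summable, of "1 / d"] d(1)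
      by (blast intro: exI[of _ "\<lambda>n. \<bar>bcoeff n\<bar> * (1 / d)"])
  qed
  thus ?thesis by (simp add: pole_sum_def[abs_def])
qed

lemma pole_sum_summable:
  assumes "x \<notin> pole_set A"
  shows "summable (\<lambda>n. if n \<in> A then of_real (bcoeff n) / (x + of_nat n - 1) else 0 :: complex)"
proof -
  obtain d where d: "d > 0" "cball x (2 * d) \<inter> pole_set A = {}"
    using assms pole_set_avoid by auto
  show ?thesis
    by (rule summable_comparison_test'[OF summable_mult2[OF bcoeff_summable, of "1 / d"], of 0])
       (use norm_pole_sum_term_le[OF d, of x] d(1) in auto)
qed

text \<open>The index set of \<open>pole_sum\<close> exists for this step: with \<open>N\<close>
  removed, the remaining sum is holomorphic at the pole 1 - N.\<close>

lemma pole_sum_split: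
  assumes "s \<notin> pole_set UNIV"
  shows "pole_sum UNIV s = of_real (bcoeff N) / (s + of_nat N - 1) + pole_sum (- {N}) s"
proof -
  have s1: "(\<lambda>n. if n = N then of_real (bcoeff N) / (s + of_nat N - 1) else 0) sums
      (of_real (bcoeff N) / (s + of_nat N - 1) :: complex)"
    by (rule sums_single)
  have "s \<notin> pole_set (- {N})" using assms by (auto simp: pole_set_def)
  from summable_sums[OF pole_sum_summable[OF this]]
  have s2: "(\<lambda>n. if n \<in> - {N} then of_real (bcoeff n) / (s + of_nat n - 1) else 0) sums
      pole_sum (- {N}) s" by (simp add: pole_sum_def)
  have "pole_sum UNIV s = (\<Sum>n. (if n = N then of_real (bcoeff N) / (s + of_nat N - 1) else 0)
     + (if n \<in> - {N} then of_real (bcoeff n) / (s + of_nat n - 1) else 0))"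
    unfolding pole_sum_def by (intro suminf_cong) auto
  also have "\<dots> = of_real (bcoeff N) / (s + of_nat N - 1) + pole_sum (- {N}) s"
    using sums_unique[OF sums_add[OF s1 s2]] by simp
  finally show ?thesis .
qed

definition entire_part :: "complex \<Rightarrow> complex" where
  "entire_part s = (\<Sum>k. of_real (ecoeff k) * s ^ k)"

lemma entire_part_holomorphic: "entire_part holomorphic_on A"
proof -
  have "(\<lambda>k. of_real (ecoeff k) * (s - 0) ^ k) sums entire_part s" for s :: complex
    unfolding entire_part_def diff_zero
  proof (rule summable_sums, rule summable_norm_cancel)
    show "summable (\<lambda>k. norm (of_real (ecoeff k) * s ^ k))"
      using ecoeff_summable_nonneg[of "norm s"] ecoeff_nonneg by (simp add: norm_mult norm_power mult.commute)
  qed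
  hence "entire_part holomorphic_on ball 0 r" for r
    by (rule power_series_holomorphic)
  hence "entire_part field_differentiable (at s)" for s
    using holomorphic_on_imp_differentiable_at[of entire_part "ball 0 (norm s + 1)" s] by auto
  thus ?thesis
    using field_differentiable_at_within holomorphic_on_def by blast
qed

definition mellin_cont :: "complex \<Rightarrow> complex" where
  "mellin_cont s = pole_sum UNIV s + entire_part s"

lemma mellin_cont_of_real: "mellin_cont (of_real s) = of_real (mellin_bose s)" if "\<And>n. s + real n \<noteq> 1"
proof -
  have "of_real s \<notin> pole_set UNIV"
  proof
    assume "complex_of_real s \<in> pole_set UNIV"
    then obtain n where "complex_of_real s = of_real (1 - real n)" by (auto simp: pole_set_def)
    thus False using that[of n] by (simp only: of_real_eq_iff)
  qed
  from pole_sum_summable[OF this]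
  have "summable (\<lambda>n. of_real (bcoeff n / (s + real n - 1)) :: complex)" by simp
  hence "(\<lambda>n. bcoeff n / (s + real n - 1)) sums (\<Sum>n. bcoeff n / (s + real n - 1))"
    by (simp only: summable_complex_of_real summable_sums)
  hence 1: "pole_sum UNIV (of_real s) = of_real (\<Sum>n. bcoeff n / (s + real n - 1))"
    using sums_unique[OF sums_of_real[where 'a=complex]] by (auto simp: pole_sum_def)
  have "summable (\<lambda>k. s ^ k * ecoeff k)"
  proof (rule summable_norm_cancel)
    show "summable (\<lambda>k. norm (s ^ k * ecoeff k))"
      using ecoeff_summable_nonneg[of "\<bar>s\<bar>"] ecoeff_nonneg by (simp add: abs_mult power_abs)
  qed
  hence 2: "entire_part (of_real s) = of_real (\<Sum>k. s ^ k * ecoeff k)"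
  proof -
    assume "summable (\<lambda>k. s ^ k * ecoeff k)"
    hence "(\<lambda>k. complex_of_real (s ^ k * ecoeff k)) sums of_real (\<Sum>k. s ^ k * ecoeff k)"
      by (intro sums_of_real summable_sums)
    from sums_unique[OF this] show ?thesis by (simp add: entire_part_def mult.commute)
  qed
  show ?thesis using 1 2 by (simp add: mellin_cont_def mellin_bose_def)
qed

lemma mellin_cont_holomorphic: "mellin_cont holomorphic_on - pole_set UNIV"
  unfolding mellin_cont_def by (intro holomorphic_intros pole_sum_holomorphic entire_part_holomorphic)

text \<open>The zeros of \<open>1 / \<Gamma>\<close> cancel all poles of the Mellin transform except the one at \<open>1\<close>.\<close>

definition zeta_ext :: "complex \<Rightarrow> complex" where
  "zeta_ext = remove_sings (\<lambda>s. rGamma s * mellin_cont s)"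

lemma rGamma_mellin_cont_analytic:
  assumes "s \<notin> pole_set UNIV"
  shows "(\<lambda>s. rGamma s * mellin_cont s) analytic_on {s}"
proof -
  have "(\<lambda>s. rGamma s * mellin_cont s) holomorphic_on - pole_set UNIV"
    by (intro holomorphic_intros mellin_cont_holomorphic)
  thus ?thesis
    using assms closed_pole_set[of UNIV] by (auto simp: analytic_at)
qed

lemma zeta_ext_eq:
  assumes "s \<notin> pole_set UNIV"
  shows "zeta_ext s = rGamma s * mellin_cont s"
  unfolding zeta_ext_def using rGamma_mellin_cont_analytic[OF assms] by (rule remove_sings_at_analytic)

text \<open>Once the term of index \<open>N\<close> is split off, the remainder is continuous at 1 -
  N and is killed by the factor s - (1 - N).\<close>

lemma mellin_cont_residue:
  "(\<lambda>s. (s - (1 - of_nat N)) * mellin_cont s) \<midarrow>1 - of_nat N\<rightarrow> of_real (bcoeff N)"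
proof -
  let ?s0 = "1 - of_nat N :: complex"
  have nin: "?s0 \<notin> pole_set (- {N})" by (auto simp: pole_set_def)
  let ?r = "\<lambda>s. pole_sum (- {N}) s + entire_part s"
  have "isCont ?r ?s0"
  proof (rule continuous_on_interior)
    show "continuous_on (- pole_set (- {N})) (\<lambda>s. pole_sum (- {N}) s + entire_part s)"
      by (intro holomorphic_on_imp_continuous_on holomorphic_intros pole_sum_holomorphic
          entire_part_holomorphic)
    show "?s0 \<in> interior (- pole_set (- {N}))"
      using nin closed_pole_set by (simp add: interior_open open_Compl)
  qed
  hence "?r \<midarrow>?s0\<rightarrow> ?r ?s0" by (simp add: isCont_def)
  hence "(\<lambda>s. of_real (bcoeff N) + (s - ?s0) * ?r s)
     \<midarrow>?s0\<rightarrow> of_real (bcoeff N) + (?s0 - ?s0) * ?r ?s0"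
    by (intro tendsto_add[OF tendsto_const] tendsto_mult tendsto_diff tendsto_ident_at tendsto_const)
  hence "(\<lambda>s. of_real (bcoeff N) + (s - ?s0) * ?r s) \<midarrow>?s0\<rightarrow> of_real (bcoeff N)"
    by simp
  moreover have "eventually (\<lambda>s. s \<in> - pole_set (- {N}) - {?s0}) (at ?s0)"
    using nin closed_pole_set[of "- {N}"] by (intro eventually_at_in_open) auto
  hence "eventually (\<lambda>s. of_real (bcoeff N) + (s - ?s0) * ?r s = (s - ?s0) * mellin_cont s) (at ?s0)"
  proof eventually_elim
    case (elim s)
    hence "s \<notin> pole_set UNIV" by (auto simp: pole_set_def)
    thus ?case using elim pole_sum_split[of s N]
      by (simp add: mellin_cont_def field_simps)
  qed
  ultimately show ?thesis
    by (auto intro: Lim_transform_eventually)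
qed

lemma rGamma_mellin_cont_residue_1:
  "(\<lambda>s. rGamma s * ((s - 1) * mellin_cont s)) \<midarrow>1\<rightarrow> 1"
proof -
  have "isCont rGamma (1::complex)"
    using field_differentiable_rGamma field_differentiable_imp_continuous_at by blast
  hence "rGamma \<midarrow>1\<rightarrow> rGamma (1::complex)"
    by (simp only: isCont_def)
  hence "(\<lambda>s. rGamma s * ((s - 1) * mellin_cont s)) \<midarrow>1\<rightarrow> rGamma 1 * of_real (bcoeff 0)"
    using mellin_cont_residue[of 0] by (intro tendsto_mult) auto
  thus ?thesis by (simp add: bcoeff_0)
qed

text \<open>The residue is \<open>bcoeff 0\<close> divided by Gamma(1), that is 1. It later supplies
  the limiting values in \<open>pochhammer_zeta\<close>.\<close>

lemma zeta_ext_pole: "(\<lambda>s. (s - 1) * zeta_ext s) \<midarrow>1\<rightarrow> 1"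
proof -
  note rGamma_mellin_cont_residue_1
  moreover have "eventually (\<lambda>s. s \<in> - pole_set (- {0}) - {1}) (at (1::complex))"
    using closed_pole_set[of "- {0}"] by (intro eventually_at_in_open) (auto simp: pole_set_def)
  hence "eventually (\<lambda>s. rGamma s * ((s - 1) * mellin_cont s) = (s - 1) * zeta_ext s) (at 1)"
  proof eventually_elim
    case (elim s)
    hence "s \<notin> pole_set UNIV" by (auto simp: pole_set_def)
    thus ?case by (simp add: zeta_ext_eq)
  qed
  ultimately show ?thesis
    by (rule Lim_transform_eventually)
qed

text \<open>\<open>remove_sings\<close> takes the default value 0 where no finite limit exists,
  which agrees with the normalisation of \<open>zeta\<close> at 1. A finite limit at 1 would force
  residue 0 there.\<close>

lemma zeta_ext_1: "zeta_ext 1 = 0"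
proof -
  let ?f = "\<lambda>s. rGamma s * mellin_cont s"
  have "\<not> (\<exists>c. ?f \<midarrow>1\<rightarrow> c)"
  proof
    assume "\<exists>c. ?f \<midarrow>1\<rightarrow> c"
    then obtain c where "?f \<midarrow>1\<rightarrow> c" by auto
    hence "(\<lambda>s. (s - 1) * ?f s) \<midarrow>1\<rightarrow> (1 - 1) * c" by (intro tendsto_intros)
    hence "(\<lambda>s. rGamma s * ((s - 1) * mellin_cont s)) \<midarrow>1\<rightarrow> 0"
      by (simp add: mult_ac)
    from tendsto_unique[OF _ this rGamma_mellin_cont_residue_1] show False by simp
  qed
  thus ?thesis by (simp add: zeta_ext_def remove_sings_def)
qed

lemma zeta_ext_holomorphic: "zeta_ext holomorphic_on - {1}"
proof -
  have "zeta_ext analytic_on {s}" if "s \<noteq> 1" for s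
  proof (cases "s \<in> pole_set UNIV")
    case False
    thus ?thesis
      unfolding zeta_ext_def by (intro remove_sings_analytic_on rGamma_mellin_cont_analytic)
  next
    case True
    then obtain N where N: "s = 1 - of_nat N" by (auto simp: pole_set_def)
    \<comment> \<open>The case \<open>N = 0\<close> is the excluded point 1, so \<open>s\<close> is
      a nonpositive integer.\<close>
    have s0: "rGamma s = 0"
      using N that by (cases N) (auto simp: rGamma_eq_zero_iff nonpos_Ints_def)
    show ?thesis
      unfolding zeta_ext_def
    proof (rule remove_sings_analytic_at)
      show "isolated_singularity_at (\<lambda>s. rGamma s * mellin_cont s) s"
      proof (rule isolated_singularity_at_holomorphic)
        show "(\<lambda>s. rGamma s * mellin_cont s) holomorphic_on - pole_set (- {N}) - {s}"
          by (intro holomorphic_intros holomorphic_on_subset[OF mellin_cont_holomorphic])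
             (auto simp: pole_set_def N)
        show "open (- pole_set (- {N}))" using closed_pole_set by auto
        show "s \<in> - pole_set (- {N})" by (auto simp: pole_set_def N)
      qed
      obtain D where "(rGamma has_field_derivative D) (at s)"
        using field_differentiable_rGamma[of s UNIV] by (auto simp: field_differentiable_def)
      hence "(\<lambda>w. rGamma w / (w - s)) \<midarrow>s\<rightarrow> deriv rGamma s"
        using s0 DERIV_imp_deriv by (fastforce simp: has_field_derivative_iff)
      \<comment> \<open>The zero of 1 / Gamma absorbs the simple pole: each of the two factors has a
        finite limit at \<open>s\<close>.\<close>
      hence "(\<lambda>w. rGamma w / (w - s) * ((w - s) * mellin_cont w)) \<midarrow>s\<rightarrow> deriv rGamma s * of_real (bcoeff N)"
        unfolding N using mellin_cont_residue by (intro tendsto_mult)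
      thus "(\<lambda>w. rGamma w * mellin_cont w) \<midarrow>s\<rightarrow> deriv rGamma s * of_real (bcoeff N)"
        by (rule Lim_transform_eventually) (auto simp: eventually_at_filter)
    qed
  qed
  hence "zeta_ext analytic_on - {1}"
    by (subst analytic_on_analytic_at) auto
  thus ?thesis by (rule analytic_imp_holomorphic)
qed

section \<open>Identification with the zeta function\<close>

lemma islimpt_of_real_image:
  assumes "open S" "x \<in> S"
  shows "complex_of_real x islimpt of_real ` S"
proof -
  have "x islimpt S"
    using assms by (intro interior_limit_point) (simp add: interior_open)
  thus ?thesis
    unfolding islimpt_approachable by (force simp: dist_of_real)
qed

text \<open>The Mellin integral is known only for real arguments. The identity theorem carries the
  equality from the ray (1, infinity) to the half-plane.\<close>

lemma zeta_ext_eq_dirichlet: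
  assumes "Re s > 1"
  shows "zeta_ext s = dirichlet_zeta s"
proof -
  have real: "zeta_ext (of_real x) - dirichlet_zeta (of_real x) = 0" if "x > 1" for x :: real
  proof -
    have "complex_of_real x \<notin> pole_set UNIV"
    proof
      assume "complex_of_real x \<in> pole_set UNIV"
      then obtain n where "complex_of_real x = of_real (1 - real n)" by (auto simp: pole_set_def)
      thus False using that by (simp only: of_real_eq_iff)
    qed
    hence "zeta_ext (of_real x) = rGamma (of_real x) * of_real (mellin_bose x)"
      using that by (simp add: zeta_ext_eq mellin_cont_of_real)
    also have "\<dots> = rGamma (of_real x) * Gamma (of_real x) * of_real (\<Sum>n. real (Suc n) powr - x)"
      using that by (simp add: mellin_bose_eq_Dirichlet Gamma_complex_of_real)
    also have "rGamma (of_real x) * Gamma (complex_of_real x) = 1"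
    proof -
      have "Gamma (complex_of_real x) \<noteq> 0"
        using that Gamma_real_pos[of x] by (simp add: Gamma_complex_of_real del: Gamma_real_pos)
      thus ?thesis by (simp add: Gamma_def)
    qed
    also have "of_real (\<Sum>n. real (Suc n) powr - x) = dirichlet_zeta (of_real x)"
    proof -
      have "1 / of_nat (Suc n) powr of_real x = complex_of_real (real (Suc n) powr - x)" for n
        using powr_of_real[of "real (Suc n)" x] by (simp add: powr_minus divide_inverse)
      moreover have "(\<lambda>n. complex_of_real (real (Suc n) powr - x)) sums of_real (\<Sum>n. real (Suc n) powr - x)"
        using summable_Dirichlet_real[OF that] by (intro sums_of_real summable_sums)
      ultimately show ?thesis
        by (simp only: dirichlet_zeta_def sums_iff)
    qed
    finally show ?thesis by simp
  qed
  have "zeta_ext s - dirichlet_zeta s = 0"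
  proof (rule analytic_continuation[where S="{s. Re s > 1}" and U="of_real ` {1<..}" and \<xi>=2
        and f="\<lambda>s. zeta_ext s - dirichlet_zeta s"])
    show "(\<lambda>s. zeta_ext s - dirichlet_zeta s) holomorphic_on {s. 1 < Re s}"
      by (intro holomorphic_intros dirichlet_zeta_holomorphic holomorphic_on_subset[OF zeta_ext_holomorphic])
         auto
    show "connected {s. 1 < Re s}"
      by (intro convex_connected convex_halfspace_Re_gt)
    show "(2::complex) islimpt of_real ` {1<..}"
      using islimpt_of_real_image[of "{1<..}" 2] by simp
  qed (use real assms in \<open>auto simp: open_halfspace_Re_gt\<close>)
  thus ?thesis by simp
qed

text \<open>The punctured plane is connected, so the half-plane determines the function away from 1,
  and the clause at 1 fixes the rest.\<close>

lemma zeta_unique: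
  assumes "f holomorphic_on (- {1})" "\<forall>s. Re s > 1 \<longrightarrow> (\<lambda>n. 1 / of_nat (Suc n) powr s) sums f s" "f 1 = 0"
    and "g holomorphic_on (- {1})" "\<forall>s. Re s > 1 \<longrightarrow> (\<lambda>n. 1 / of_nat (Suc n) powr s) sums g s" "g 1 = 0"
  shows "f = (g :: complex \<Rightarrow> complex)"
proof
  fix z
  show "f z = g z"
  proof (cases "z = 1")
    case False
    show ?thesis
    proof (rule analytic_continuation_open[of "{s. Re s > 1}" "- {1}" f g])
      show "{s. Re s > 1} \<noteq> {}" by (auto intro!: exI[of _ 2])
      show "connected (- {1::complex})"
        by (intro connected_punctured_universe) auto
      show "f z = g z" if "z \<in> {s. Re s > 1}" for z
        using assms that sums_unique2 by blast
    qed (use assms False in \<open>auto simp: open_halfspace_Re_gt\<close>)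
  qed (use assms in auto)
qed

lemma zeta_eq_zeta_ext: "zeta = zeta_ext"
  unfolding zeta_def
proof (rule the_equality)
  show *: "zeta_ext holomorphic_on (- {1}) \<and>
     (\<forall>s. Re s > 1 \<longrightarrow> (\<lambda>n. 1 / of_nat (Suc n) powr s) sums zeta_ext s) \<and> zeta_ext 1 = 0"
    using zeta_ext_holomorphic zeta_ext_1 zeta_ext_eq_dirichlet dirichlet_zeta_sums by simp
  show "f = zeta_ext" if "f holomorphic_on (- {1}) \<and>
     (\<forall>s. Re s > 1 \<longrightarrow> (\<lambda>n. 1 / of_nat (Suc n) powr s) sums f s) \<and> f 1 = 0" for f
    using that * zeta_unique[of f zeta_ext] by blast
qed

lemma zeta_holomorphic: "zeta holomorphic_on - {1}"
  by (simp add: zeta_eq_zeta_ext zeta_ext_holomorphic)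

lemma zeta_pole: "(\<lambda>s. (s - 1) * zeta s) \<midarrow>1\<rightarrow> 1"
  by (simp add: zeta_eq_zeta_ext zeta_ext_pole)

text \<open>The bound is zeta(2). It makes the factors zeta(a + j) harmless for all large
  \<open>j\<close>.\<close>

lemma norm_zeta_le:
  assumes "Re s \<ge> 2"
  shows "norm (zeta s) \<le> (\<Sum>n. real (Suc n) powr - 2)"
proof -
  have sm: "summable (\<lambda>n. real (Suc n) powr - 2)"
    by (rule summable_Dirichlet_real) auto
  have "zeta s = (\<Sum>n. 1 / of_nat (Suc n) powr s)"
    using assms by (simp add: zeta_eq_zeta_ext zeta_ext_eq_dirichlet dirichlet_zeta_def)
  also have "norm \<dots> \<le> (\<Sum>n. real (Suc n) powr - 2)"
  proof (rule norm_suminf_le[OF _ sm])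
    show "norm (1 / of_nat (Suc n) powr s :: complex) \<le> real (Suc n) powr - 2" for n
      unfolding norm_inverse_nat_powr using assms by (intro powr_mono) auto
  qed
  finally show ?thesis .
qed

text \<open>For non-integer \<open>s\<close> neither a pole of the Mellin transform nor a zero of 1
  / Gamma interferes. The arguments needed later, a + j with 0 < a < 1 and a + b - 1 in (-1, 0), are
  of this kind.\<close>

lemma mellin_bose_eq_zeta:
  assumes "s \<notin> \<int>"
  shows "of_real (mellin_bose s) = Gamma (of_real s) * zeta (of_real s)"
proof -
  have nin: "s + real n \<noteq> 1" for n
  proof
    assume "s + real n = 1"
    hence "s = of_int (1 - int n)" by simp
    thus False using assms Ints_of_int by blast
  qed
  have "complex_of_real s \<notin> pole_set UNIV"
  proof
    assume "complex_of_real s \<in> pole_set UNIV"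
    then obtain n where "complex_of_real s = of_real (1 - real n)" by (auto simp: pole_set_def)
    thus False using nin[of n] by (simp only: of_real_eq_iff)
  qed
  hence "zeta (of_real s) = rGamma (of_real s) * of_real (mellin_bose s)"
    using nin by (simp add: zeta_eq_zeta_ext zeta_ext_eq mellin_cont_of_real)
  moreover have "rGamma (complex_of_real s) \<noteq> 0"
    using assms nonpos_Ints_subset_Ints[where 'a=real]
    by (auto simp: rGamma_eq_zero_iff of_real_in_nonpos_Ints_iff)
  ultimately show ?thesis by (simp add: Gamma_def)
qed

subsection \<open>Convergence of the double series\<close>

lemma has_sum_nat_pairs:
  fixes f :: "nat \<times> nat \<Rightarrow> 'a::banach"
  assumes "summable (\<lambda>i. norm (f (prod_decode i)))"
  shows "(f has_sum (\<Sum>i. f (prod_decode i))) UNIV"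
proof -
  have "((\<lambda>i. f (prod_decode i)) has_sum (\<Sum>i. f (prod_decode i))) UNIV"
    by (rule norm_summable_imp_has_sum[OF assms summable_sums[OF summable_norm_cancel[OF assms]]])
  thus ?thesis
    by (subst (asm) has_sum_reindex_bij_betw[OF bij_prod_decode])
qed

text \<open>Enumerating pairs by \<open>prod_decode\<close> makes the double series an ordinary
  series, to which the majorant test and termwise integration apply. Absolute convergence then
  recovers the iterated sums of the theorem.\<close>

lemma iterated_sums_prod_decode:
  fixes f :: "nat \<Rightarrow> nat \<Rightarrow> 'a::banach"
  assumes "summable (\<lambda>i. norm (case prod_decode i of (j, k) \<Rightarrow> f j k))"
  shows "summable (f j)"
    and "(\<lambda>j. \<Sum>k. f j k) sums (\<Sum>i. case prod_decode i of (j, k) \<Rightarrow> f j k)"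
proof -
  let ?f = "\<lambda>(j, k). f j k"
  have hs: "(?f has_sum (\<Sum>i. ?f (prod_decode i))) (UNIV \<times> UNIV)"
    unfolding UNIV_Times_UNIV by (rule has_sum_nat_pairs) (rule assms)
  have "summable (\<lambda>i. norm (norm (?f (prod_decode i))))"
    using assms by (simp only: real_norm_def abs_norm_cancel)
  from has_sum_nat_pairs[OF this] have "?f abs_summable_on (UNIV \<times> UNIV)"
    unfolding UNIV_Times_UNIV by (rule has_sum_imp_summable)
  hence "\<forall>j\<in>UNIV. (\<lambda>k. ?f (j, k)) abs_summable_on UNIV"
    using Infinite_Sum.abs_summable_on_Sigma_iff[of ?f UNIV "\<lambda>_. UNIV"] by blast
  hence inner: "f j summable_on UNIV" for j
  proof -
    from \<open>\<forall>j\<in>UNIV. (\<lambda>k. ?f (j, k)) abs_summable_on UNIV\<close>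
    have "f j abs_summable_on UNIV" by (simp only: prod.case UNIV_I simp_thms ball_UNIV)
    thus ?thesis by (rule Infinite_Sum.abs_summable_summable)
  qed
  thus sm: "summable (f j)" for j
    by (rule summable_on_imp_summable)
  have "(f j has_sum (\<Sum>k. f j k)) UNIV" for j
  proof -
    note * = has_sum_infsum[OF inner[of j]]
    from sums_unique[OF has_sum_imp_sums[OF this]] * show ?thesis by simp
  qed
  hence "((\<lambda>j. \<Sum>k. f j k) has_sum (\<Sum>i. ?f (prod_decode i))) UNIV"
    by (intro has_sum_SigmaD[OF hs]) (simp only: prod.case)
  thus "(\<lambda>j. \<Sum>k. f j k) sums (\<Sum>i. ?f (prod_decode i))"
    by (rule has_sum_imp_sums)
qed

lemma summable_prod_decode_mult:
  fixes p q :: "nat \<Rightarrow> real"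
  assumes "summable p" "summable q" "\<And>n. 0 \<le> p n" "\<And>n. 0 \<le> q n"
  shows "summable (\<lambda>i. case prod_decode i of (j, k) \<Rightarrow> p j * q k)"
proof -
  have p: "p summable_on UNIV" and q: "(q has_sum suminf q) UNIV"
    using assms by (auto intro!: norm_summable_imp_summable_on norm_summable_imp_has_sum)
  have "(\<lambda>(j, k). p j * q k) summable_on (UNIV \<times> UNIV)"
    by (rule summable_on_SigmaI[where g="\<lambda>j. p j * suminf q"])
       (use assms(3,4) in \<open>auto intro!: has_sum_cmult_right q summable_on_cmult_left p\<close>)
  hence "(\<lambda>i. (\<lambda>(j, k). p j * q k) (prod_decode i)) summable_on UNIV"
    by (subst summable_on_reindex_bij_betw[OF bij_prod_decode]) simp
  thus ?thesis
    by (rule summable_on_imp_summable)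
qed

section \<open>Size of the coefficients and a majorant of the double series\<close>

lemma norm_pochhammer_div_fact_le:
  fixes a :: complex
  assumes "Re a \<le> \<alpha>" "\<alpha> \<le> 1"
  shows "norm (pochhammer a j / fact j) \<le>
    exp ((norm (a - 1))\<^sup>2 * (\<Sum>n. real (Suc n) powr - 2)) * real (Suc j) powr (\<alpha> - 1)"
proof -
  let ?w = "a - 1" and ?Z = "\<Sum>n. real (Suc n) powr - 2"
  \<comment> \<open>The inequality 1 + x \<le> exp x is applied to |1 + z|^2 = 1 + (2 Re z + |z|^2).
    Doubling the |z|^2 in the exponent makes the bound a square, so that roots can be taken.\<close>
  have le_exp: "norm (1 + z) \<le> exp (Re z + (norm z)\<^sup>2)" for z :: complex
  proof -
    have "(norm (1 + z))\<^sup>2 = 1 + (2 * Re z + (norm z)\<^sup>2)"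
      unfolding cmod_power2 by (simp add: power2_eq_square algebra_simps)
    also have "\<dots> \<le> exp (2 * Re z + (norm z)\<^sup>2)"
      by (rule exp_ge_add_one_self)
    also have "\<dots> \<le> exp (2 * (Re z + (norm z)\<^sup>2))" by simp
    also have "\<dots> = (exp (Re z + (norm z)\<^sup>2))\<^sup>2"
      by (rule exp_double)
    finally show ?thesis by (rule power2_le_imp_le) auto
  qed
  \<comment> \<open>In this product form the logarithm of the modulus is at most (Re a - 1) times a
    harmonic sum, up to an error of at most |a - 1|^2 zeta(2).\<close>
  have "pochhammer a j / fact j = (\<Prod>i<j. 1 + ?w / of_nat (Suc i))"
  proof (induction j)
    case (Suc j)
    have "pochhammer a (Suc j) / fact (Suc j) = pochhammer a j / fact j * ((a + of_nat j) / of_nat (Suc j))"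
      by (simp add: pochhammer_Suc)
    also have "(a + of_nat j) / of_nat (Suc j) = 1 + ?w / of_nat (Suc j)"
      using of_nat_neq_0[of j, where 'a=complex] by (simp add: divide_simps del: of_nat_Suc) simp
    finally show ?case using Suc.IH by simp
  qed auto
  also have "norm \<dots> = (\<Prod>i<j. norm (1 + ?w / of_nat (Suc i)))"
    by (rule prod_norm[symmetric])
  also have "\<dots> \<le> (\<Prod>i<j. exp (Re (?w / of_nat (Suc i)) + (norm (?w / of_nat (Suc i)))\<^sup>2))"
    by (intro prod_mono conjI le_exp norm_ge_zero)
  also have "\<dots> = exp (\<Sum>i<j. Re (?w / of_nat (Suc i)) + (norm (?w / of_nat (Suc i)))\<^sup>2)"
    by (simp add: exp_sum)
  also have "(\<Sum>i<j. Re (?w / of_nat (Suc i)) + (norm (?w / of_nat (Suc i)))\<^sup>2)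
      = (Re a - 1) * harm j + (norm ?w)\<^sup>2 * (\<Sum>i<j. real (Suc i) powr - 2)"
  proof -
    have "Re (?w / of_nat (Suc i)) = (Re a - 1) * inverse (real (Suc i))" for i
      by (simp only: Re_divide_of_nat) (simp add: divide_inverse)
    moreover have "(norm (?w / of_nat (Suc i)))\<^sup>2 = (norm ?w)\<^sup>2 * real (Suc i) powr - 2" for i
      by (simp only: norm_divide norm_of_nat power_divide) (simp add: powr_minus divide_inverse)
    ultimately show ?thesis
      unfolding harm_altdef by (simp only: sum.distrib sum_distrib_left)
  qed
  also have "exp \<dots> \<le> exp ((\<alpha> - 1) * ln (real (Suc j)) + (norm ?w)\<^sup>2 * ?Z)"
  proof -
    have h: "ln (real (Suc j)) \<le> harm j" "0 \<le> (harm j :: real)"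
      using ln_le_harm[of j] harm_nonneg[of j] by (auto simp: add.commute)
    have "(Re a - 1) * harm j \<le> (\<alpha> - 1) * harm j"
      using assms h by (intro mult_right_mono) auto
    \<comment> \<open>The harmonic sum is at least the logarithm; the factor \<alpha> - 1 is
      nonpositive and reverses this.\<close>
    also have "\<dots> \<le> (\<alpha> - 1) * ln (real (Suc j))"
      using assms h by (intro mult_left_mono_neg) auto
    finally have "(Re a - 1) * harm j \<le> (\<alpha> - 1) * ln (real (Suc j))" .
    moreover have "(\<Sum>i<j. real (Suc i) powr - 2) \<le> ?Z"
      by (rule sum_le_suminf) (auto intro!: summable_Dirichlet_real simp del: of_nat_Suc)
    hence "(norm ?w)\<^sup>2 * (\<Sum>i<j. real (Suc i) powr - 2) \<le> (norm ?w)\<^sup>2 * ?Z"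
      by (intro mult_left_mono) auto
    ultimately show ?thesis by simp
  qed
  also have "\<dots> = exp ((norm ?w)\<^sup>2 * ?Z) * real (Suc j) powr (\<alpha> - 1)"
    by (simp add: exp_add powr_def)
  finally show ?thesis .
qed

text \<open>For j = 0 the condition Re a < 1 keeps away from the pole. For j = m + 1 the singularity
  at -m is removable: the last factor a + m of the Pochhammer symbol is s - 1 at s = a + j, and the
  remaining factors take the value (-1)^m m! there.\<close>

lemma pochhammer_zeta_holomorphic: "(\<lambda>a. pochhammer_zeta a j) holomorphic_on {a. Re a < 1}"
proof (cases j)
  case 0
  have "(\<lambda>a. zeta a) holomorphic_on {a. Re a < 1}"
    by (rule holomorphic_on_subset[OF zeta_holomorphic]) auto
  thus ?thesis
    by (rule holomorphic_transform) (auto simp: pochhammer_zeta_def 0)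
next
  case (Suc m)
  let ?a0 = "- of_nat m :: complex"
  have eq: "a + of_nat j = 1 \<longleftrightarrow> a = ?a0" for a
  proof -
    have "a + of_nat j - 1 = a + of_nat m" by (simp add: Suc)
    hence "a + of_nat j = 1 \<longleftrightarrow> a + of_nat m = 0" by (metis right_minus_eq)
    thus ?thesis by (simp only: eq_neg_iff_add_eq_0)
  qed
  show ?thesis
  proof (rule no_isolated_singularity'[where K="{?a0}"])
    have "(zeta \<circ> (\<lambda>a. a + of_nat j)) holomorphic_on {a. Re a < 1} - {?a0}"
    proof (rule holomorphic_on_compose_gen[OF _ zeta_holomorphic])
      show "(\<lambda>a. a + of_nat j) holomorphic_on {a. Re a < 1} - {?a0}"
        by (intro holomorphic_intros)
      show "(\<lambda>a. a + of_nat j) ` ({a. Re a < 1} - {?a0}) \<subseteq> - {1}"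
      proof (rule image_subsetI)
        fix a assume "a \<in> {a. Re a < 1} - {?a0}"
        hence "a \<noteq> ?a0" by blast
        hence "a + of_nat j \<noteq> 1" by (simp only: eq not_False_eq_True)
        thus "a + of_nat j \<in> - {1}" by blast
      qed
    qed
    moreover have "(\<lambda>a. pochhammer a j) holomorphic_on {a. Re a < 1} - {?a0}"
      by (intro holomorphic_intros)
    ultimately have "(\<lambda>a. pochhammer a j * zeta (a + of_nat j)) holomorphic_on {a. Re a < 1} - {?a0}"
      unfolding o_def by (rule holomorphic_on_mult[rotated])
    thus "(\<lambda>a. pochhammer_zeta a j) holomorphic_on {a. Re a < 1} - {?a0}"
      by (rule holomorphic_transform) (auto simp: pochhammer_zeta_def eq)
    have "isCont (\<lambda>a. pochhammer a m) ?a0"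
      by (simp only: pochhammer_prod) (intro continuous_intros)
    moreover have "(\<lambda>a. (a + of_nat j - 1) * zeta (a + of_nat j)) \<midarrow>?a0\<rightarrow> 1"
      using LIM_offset[OF zeta_pole, of "of_nat j"] by (simp add: Suc)
    ultimately have "(\<lambda>a. pochhammer a m * ((a + of_nat j - 1) * zeta (a + of_nat j)))
        \<midarrow>?a0\<rightarrow> pochhammer ?a0 m * 1"
      by (intro tendsto_mult) (auto simp: isCont_def)
    moreover have "pochhammer ?a0 m * 1 = pochhammer_zeta ?a0 j"
      by (simp add: pochhammer_zeta_def Suc pochhammer_same)
    ultimately have "(\<lambda>a. pochhammer a m * ((a + of_nat j - 1) * zeta (a + of_nat j)))
        \<midarrow>?a0\<rightarrow> pochhammer_zeta ?a0 j" by simp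
    hence "(\<lambda>a. pochhammer_zeta a j) \<midarrow>?a0\<rightarrow> pochhammer_zeta ?a0 j"
      by (rule Lim_transform_eventually)
         (auto simp: eventually_at_filter pochhammer_zeta_def eq_neg_iff_add_eq_0 Suc pochhammer_Suc mult_ac)
    thus "((\<lambda>a. pochhammer_zeta a j) \<longlongrightarrow> pochhammer_zeta a j) (at a within {a. Re a < 1})"
      if "a \<in> {?a0}" for a
      using that by (auto intro: filterlim_mono at_le)
  qed (auto simp: open_halfspace_Re_lt)
qed

text \<open>For large \<open>j\<close> the growth bound and \<open>norm_zeta_le\<close> apply. The
  finitely many remaining functions are continuous, hence bounded on \<open>K\<close>, which also
  covers the removable singularities.\<close>

lemma pochhammer_zeta_bound:
  assumes "compact K" "\<And>a. a \<in> K \<Longrightarrow> Re a \<le> \<alpha>" "\<alpha> < 1"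
  obtains C where "C \<ge> 0"
    "\<And>a j. a \<in> K \<Longrightarrow> norm (pochhammer_zeta a j / fact j) \<le> C * real (Suc j) powr (\<alpha> - 1)"
proof -
  let ?Z = "\<Sum>n. real (Suc n) powr - 2"
  have Z: "?Z \<ge> 0" by (intro suminf_nonneg summable_Dirichlet_real) auto
  obtain R where R: "\<And>a. a \<in> K \<Longrightarrow> norm a \<le> R"
    using compact_imp_bounded[OF assms(1)] by (auto simp: bounded_iff)
  \<comment> \<open>From this index on, Re (a + j) \<ge> 2 for every \<open>a\<close> of modulus at
    most \<open>R\<close>.\<close>
  define J where "J = nat \<lceil>R + 2\<rceil>"
  define C0 where "C0 = exp ((R + 1)\<^sup>2 * ?Z) * ?Z"
  have C0: "C0 \<ge> 0" using Z by (simp add: C0_def)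
  have large: "norm (pochhammer_zeta a j / fact j) \<le> C0 * real (Suc j) powr (\<alpha> - 1)"
    if a: "a \<in> K" and j: "j \<ge> J" for a j
  proof -
    have "R + 2 \<le> real j" using j unfolding J_def by linarith
    hence re: "Re (a + of_nat j) \<ge> 2"
      using R[OF a] abs_Re_le_cmod[of a] by simp
    hence "a + of_nat j = 1 \<Longrightarrow> (1::real) \<ge> 2" by (metis one_complex.sel(1))
    hence ne: "a + of_nat j \<noteq> 1" by auto
    have "norm (a - 1) \<le> R + 1"
      using norm_triangle_ineq4[of a 1] R[OF a] by simp
    hence "(norm (a - 1))\<^sup>2 * ?Z \<le> (R + 1)\<^sup>2 * ?Z"
      using Z by (intro mult_right_mono power_mono) auto
    hence le: "exp ((norm (a - 1))\<^sup>2 * ?Z) * real (Suc j) powr (\<alpha> - 1) \<le>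
       exp ((R + 1)\<^sup>2 * ?Z) * real (Suc j) powr (\<alpha> - 1)"
      by (intro mult_right_mono) auto
    have "norm (pochhammer a j / fact j) \<le> exp ((R + 1)\<^sup>2 * ?Z) * real (Suc j) powr (\<alpha> - 1)"
      by (rule order.trans[OF norm_pochhammer_div_fact_le le]) (use assms(2)[OF a] assms(3) in auto)
    hence "norm (pochhammer a j / fact j) * norm (zeta (a + of_nat j)) \<le>
        (exp ((R + 1)\<^sup>2 * ?Z) * real (Suc j) powr (\<alpha> - 1)) * ?Z"
      using norm_zeta_le[OF re] by (intro mult_mono) auto
    thus ?thesis
      using ne by (simp add: pochhammer_zeta_def C0_def norm_mult norm_divide mult_ac)
  qed
  have "\<exists>B. \<forall>a\<in>K. norm (pochhammer_zeta a j / fact j) \<le> B" for j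
  proof -
    have "continuous_on K (\<lambda>a. pochhammer_zeta a j / fact j)"
      by (intro continuous_intros holomorphic_on_imp_continuous_on
          holomorphic_on_subset[OF pochhammer_zeta_holomorphic]) (use assms in force)+
    hence "bounded ((\<lambda>a. pochhammer_zeta a j / fact j) ` K)"
      using assms(1) by (intro compact_imp_bounded compact_continuous_image)
    thus ?thesis by (auto simp: bounded_iff)
  qed
  then obtain B where B: "\<And>a j. a \<in> K \<Longrightarrow> norm (pochhammer_zeta a j / fact j) \<le> B j"
    by metis
  \<comment> \<open>Dividing by the power of j + 1 and adding up the small indices gives one
    constant for all \<open>j\<close>.\<close>
  define C where "C = C0 + (\<Sum>j<J. \<bar>B j\<bar> / real (Suc j) powr (\<alpha> - 1))"
  show ?thesis
  proof (rule that[of C])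
    show "C \<ge> 0" using C0 by (auto simp: C_def intro!: add_nonneg_nonneg sum_nonneg)
    fix a j assume a: "a \<in> K"
    show "norm (pochhammer_zeta a j / fact j) \<le> C * real (Suc j) powr (\<alpha> - 1)"
    proof (cases "j < J")
      case True
      have "\<bar>B j\<bar> / real (Suc j) powr (\<alpha> - 1) \<le> (\<Sum>j<J. \<bar>B j\<bar> / real (Suc j) powr (\<alpha> - 1))"
        using True by (intro member_le_sum) auto
      also have "\<dots> \<le> C" using C0 by (simp add: C_def)
      finally have "\<bar>B j\<bar> / real (Suc j) powr (\<alpha> - 1) * real (Suc j) powr (\<alpha> - 1)
          \<le> C * real (Suc j) powr (\<alpha> - 1)" by (intro mult_right_mono) auto
      hence "\<bar>B j\<bar> \<le> C * real (Suc j) powr (\<alpha> - 1)" by simp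
      thus ?thesis using B[OF a, of j] by linarith
    next
      case False
      have "C0 * real (Suc j) powr (\<alpha> - 1) \<le> C * real (Suc j) powr (\<alpha> - 1)"
        by (intro mult_right_mono) (auto simp: C_def intro!: sum_nonneg)
      thus ?thesis using large[OF a, of j] False order.trans not_less by blast
    qed
  qed
qed

text \<open>Both j + 1 and k + 1 are at most j + k + 1. The inequality replaces the coupled weight 1
  / (j + k + 1) by a product of powers.\<close>

lemma powr_le_add_nat:
  assumes "0 \<le> \<theta>" "\<theta> \<le> 1"
  shows "real (Suc j) powr \<theta> * real (Suc k) powr (1 - \<theta>) \<le> real (j + k + 1)"
proof -
  have "real (Suc j) powr \<theta> * real (Suc k) powr (1 - \<theta>)
      \<le> real (j + k + 1) powr \<theta> * real (j + k + 1) powr (1 - \<theta>)"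
    using assms by (intro mult_mono powr_mono2) auto
  also have "\<dots> = real (j + k + 1)"
    by (simp flip: powr_add)
  finally show ?thesis .
qed

lemma summable_powr_kernel:
  assumes "\<alpha> < 1" "\<beta> < 1" "\<alpha> + \<beta> < 1"
  shows "summable (\<lambda>i. case prod_decode i of (j, k) \<Rightarrow>
    real (Suc j) powr (\<alpha> - 1) * real (Suc k) powr (\<beta> - 1) / real (j + k + 1))"
proof -
  \<comment> \<open>\<theta> must satisfy 0 \<le> \<theta> \<le> 1 and \<alpha> < \<theta> < 1 -
    \<beta> for both single series to converge. The three hypotheses say precisely that p < q, so
    the midpoint works; this is where the shape of the domain enters.\<close>
  define p q where "p = max 0 \<alpha>" and "q = min 1 (1 - \<beta>)"
  define \<theta> where "\<theta> = (p + q) / 2"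
  have th: "0 \<le> \<theta>" "\<theta> \<le> 1" "\<alpha> < \<theta>" "\<beta> < 1 - \<theta>"
  proof -
    have "p < q" using assms by (auto simp: p_def q_def)
    moreover have "0 \<le> p" "\<alpha> \<le> p" "q \<le> 1" "q \<le> 1 - \<beta>"
      by (auto simp: p_def q_def)
    moreover have "2 * \<theta> = p + q" by (simp add: \<theta>_def)
    ultimately show "0 \<le> \<theta>" "\<theta> \<le> 1" "\<alpha> < \<theta>" "\<beta> < 1 - \<theta>"
      by linarith+
  qed
  show ?thesis
  proof (rule summable_comparison_test'[where N=0])
    show "summable (\<lambda>i. case prod_decode i of (j, k) \<Rightarrow>
        real (Suc j) powr - (1 + \<theta> - \<alpha>) * real (Suc k) powr - (1 + (1 - \<theta>) - \<beta>))"
      using th by (intro summable_prod_decode_mult summable_Dirichlet_real) auto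
    fix i :: nat
    obtain j k where jk: "prod_decode i = (j, k)" by force
    have "real (Suc j) powr (\<alpha> - 1) * real (Suc k) powr (\<beta> - 1) / real (j + k + 1)
      \<le> real (Suc j) powr (\<alpha> - 1) * real (Suc k) powr (\<beta> - 1) /
          (real (Suc j) powr \<theta> * real (Suc k) powr (1 - \<theta>))"
      using th by (intro divide_left_mono powr_le_add_nat mult_pos_pos) auto
    also have "\<dots> = (real (Suc j) powr (\<alpha> - 1) / real (Suc j) powr \<theta>) *
        (real (Suc k) powr (\<beta> - 1) / real (Suc k) powr (1 - \<theta>))"
      by simp
    also have "\<dots> = real (Suc j) powr - (1 + \<theta> - \<alpha>) * real (Suc k) powr - (1 + (1 - \<theta>) - \<beta>)"
      by (simp only: powr_diff[symmetric]) (simp add: algebra_simps)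
    finally show "norm (case prod_decode i of (j, k) \<Rightarrow>
        real (Suc j) powr (\<alpha> - 1) * real (Suc k) powr (\<beta> - 1) / real (j + k + 1))
      \<le> (case prod_decode i of (j, k) \<Rightarrow>
        real (Suc j) powr - (1 + \<theta> - \<alpha>) * real (Suc k) powr - (1 + (1 - \<theta>) - \<beta>))"
      by (simp add: jk)
  qed
qed

text \<open>One majorant for three uses: two singletons give summability, two balls joint
  continuity, a ball and a singleton holomorphy in one variable.\<close>

lemma double_term_bound:
  assumes "compact A" "\<And>a. a \<in> A \<Longrightarrow> Re a \<le> \<alpha>" "compact B" "\<And>b. b \<in> B \<Longrightarrow> Re b \<le> \<beta>"
    and "\<alpha> < 1" "\<beta> < 1" "\<alpha> + \<beta> < 1"
  obtains M where "summable M"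
    "\<And>a b i. a \<in> A \<Longrightarrow> b \<in> B \<Longrightarrow> norm (case prod_decode i of (j, k) \<Rightarrow> double_term a b j k) \<le> M i"
proof -
  obtain C where C: "C \<ge> 0"
    "\<And>a j. a \<in> A \<Longrightarrow> norm (pochhammer_zeta a j / fact j) \<le> C * real (Suc j) powr (\<alpha> - 1)"
    using pochhammer_zeta_bound[OF assms(1,2,5)] by metis
  obtain D where D: "D \<ge> 0"
    "\<And>b j. b \<in> B \<Longrightarrow> norm (pochhammer_zeta b j / fact j) \<le> D * real (Suc j) powr (\<beta> - 1)"
    using pochhammer_zeta_bound[OF assms(3,4,6)] by metis
  let ?M = "\<lambda>i. C * D * (case prod_decode i of (j, k) \<Rightarrow>
    real (Suc j) powr (\<alpha> - 1) * real (Suc k) powr (\<beta> - 1) / real (j + k + 1))"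
  show ?thesis
  proof (rule that[of ?M])
    show "summable ?M"
      by (intro summable_mult summable_powr_kernel assms)
    fix a b i assume ab: "a \<in> A" "b \<in> B"
    obtain j k where jk: "prod_decode i = (j, k)" by force
    have "norm (double_term a b j k) = norm (pochhammer_zeta a j / fact j) *
        norm (pochhammer_zeta b k / fact k) / real (j + k + 1)"
      by (simp add: double_term_def norm_mult norm_divide del: of_nat_Suc of_nat_add)
    also have "\<dots> \<le> (C * real (Suc j) powr (\<alpha> - 1)) * (D * real (Suc k) powr (\<beta> - 1)) / real (j + k + 1)"
      using C(1) D(1) C(2)[OF ab(1)] D(2)[OF ab(2)] by (intro divide_right_mono mult_mono) auto
    finally show "norm (case prod_decode i of (j, k) \<Rightarrow> double_term a b j k) \<le> ?M i"
      by (simp add: jk mult_ac)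
  qed
qed

section \<open>The double sum as a function of its parameters\<close>

definition double_sum :: "complex \<Rightarrow> complex \<Rightarrow> complex" where
  "double_sum a b = (\<Sum>i. case prod_decode i of (j, k) \<Rightarrow> double_term a b j k)"

lemma double_sum_abs_summable:
  assumes "(a, b) \<in> domain_ab"
  shows "summable (\<lambda>i. norm (case prod_decode i of (j, k) \<Rightarrow> double_term a b j k))"
proof -
  obtain M where M: "summable M"
    "\<And>x y i. x \<in> {a} \<Longrightarrow> y \<in> {b} \<Longrightarrow> norm (case prod_decode i of (j, k) \<Rightarrow> double_term x y j k) \<le> M i"
    by (rule double_term_bound[of "{a}" "Re a" "{b}" "Re b"]) (use assms in \<open>auto simp: domain_ab_def\<close>)
  show ?thesis
    by (rule summable_comparison_test'[OF M(1), of 0]) (use M(2) in auto)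
qed

lemma double_term_continuous:
  assumes "\<And>a. a \<in> A \<Longrightarrow> Re a < 1" "\<And>b. b \<in> B \<Longrightarrow> Re b < 1"
  shows "continuous_on (A \<times> B) (\<lambda>(a, b). double_term a b j k)"
proof -
  have c: "continuous_on S (\<lambda>a. pochhammer_zeta a i)" if "\<And>a. a \<in> S \<Longrightarrow> Re a < 1" for S i
    by (rule holomorphic_on_imp_continuous_on, rule holomorphic_on_subset[OF pochhammer_zeta_holomorphic])
       (use that in blast)
  have "continuous_on (A \<times> B) (\<lambda>p. pochhammer_zeta (fst p) j)"
    by (rule continuous_on_compose2[OF c[of A] continuous_on_fst[OF continuous_on_id]]) (use assms in auto)
  moreover have "continuous_on (A \<times> B) (\<lambda>p. pochhammer_zeta (snd p) k)"
    by (rule continuous_on_compose2[OF c[of B] continuous_on_snd[OF continuous_on_id]]) (use assms in auto)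
  ultimately show ?thesis
    unfolding double_term_def case_prod_unfold
    by (intro continuous_on_divide continuous_on_mult continuous_on_const) (auto simp del: of_nat_Suc)
qed

text \<open>Joint continuity is required because both parameters vary in the limit of the
  theorem.\<close>

lemma double_sum_isCont:
  assumes "(a, b) \<in> domain_ab"
  shows "isCont (\<lambda>(x, y). double_sum x y) (a, b)"
proof -
  \<comment> \<open>Both real parts may grow by \<open>r\<close>, which costs 2 r in the condition
    on the sum; a quarter of the smallest slack leaves all three inequalities strict.\<close>
  define r where "r = min (1 - Re a) (min (1 - Re b) (1 - Re a - Re b)) / 4"
  have r: "r > 0" "Re a + r < 1" "Re b + r < 1" "(Re a + r) + (Re b + r) < 1"
  proof -
    show "r > 0" using assms by (auto simp: r_def domain_ab_def)
    moreover have "4 * r \<le> 1 - Re a" "4 * r \<le> 1 - Re b" "4 * r \<le> 1 - Re a - Re b"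
      by (auto simp: r_def min_def)
    ultimately show "Re a + r < 1" "Re b + r < 1" "(Re a + r) + (Re b + r) < 1"
      by linarith+
  qed
  have re: "Re x \<le> Re c + r" if "x \<in> cball c r" for x c
    using that abs_Re_le_cmod[of "c - x"] by (auto simp: dist_norm)
  obtain M where M: "summable M" "\<And>x y i. x \<in> cball a r \<Longrightarrow> y \<in> cball b r \<Longrightarrow>
      norm (case prod_decode i of (j, k) \<Rightarrow> double_term x y j k) \<le> M i"
    by (rule double_term_bound[of "cball a r" "Re a + r" "cball b r" "Re b + r"]) (use r re in auto)
  have "continuous_on (cball a r \<times> cball b r) (\<lambda>p. \<Sum>i. case prod_decode i of (j, k) \<Rightarrow> double_term (fst p) (snd p) j k)"
  proof (rule uniform_limit_theorem[OF _ Weierstrass_m_test[where M=M]])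
    show "\<forall>\<^sub>F n in sequentially. continuous_on (cball a r \<times> cball b r)
        (\<lambda>p. \<Sum>i<n. case prod_decode i of (j, k) \<Rightarrow> double_term (fst p) (snd p) j k)"
    proof (intro always_eventually allI continuous_on_sum)
      fix i
      obtain j k where jk: "prod_decode i = (j, k)" by force
      have "continuous_on (cball a r \<times> cball b r) (\<lambda>(a, b). double_term a b j k)"
        using r re by (intro double_term_continuous) force+
      thus "continuous_on (cball a r \<times> cball b r)
          (\<lambda>p. case prod_decode i of (j, k) \<Rightarrow> double_term (fst p) (snd p) j k)"
        by (simp add: jk case_prod_unfold)
    qed
  qed (use M in auto)
  hence "continuous_on (cball a r \<times> cball b r) (\<lambda>(x, y). double_sum x y)"
    by (simp add: double_sum_def case_prod_unfold)
  moreover have "(a, b) \<in> interior (cball a r \<times> cball b r)"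
    using r by (simp add: interior_Times)
  ultimately show ?thesis by (rule continuous_on_interior)
qed

lemma double_sum_holomorphic_left:
  assumes "Re b < 1"
  shows "(\<lambda>a. double_sum a b) holomorphic_on {a. Re a < min 1 (1 - Re b)}"
  unfolding double_sum_def
proof (rule holomorphic_suminf)
  fix i
  obtain j k where jk: "prod_decode i = (j, k)" by force
  have "(\<lambda>a. pochhammer_zeta a j) holomorphic_on {a. Re a < min 1 (1 - Re b)}"
    by (rule holomorphic_on_subset[OF pochhammer_zeta_holomorphic]) auto
  thus "(\<lambda>a. case prod_decode i of (j, k) \<Rightarrow> double_term a b j k) holomorphic_on {a. Re a < min 1 (1 - Re b)}"
    unfolding jk double_term_def by (auto intro!: holomorphic_intros simp del: of_nat_Suc)
next
  fix a assume a: "a \<in> {a. Re a < min 1 (1 - Re b)}"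
  define r where "r = (min 1 (1 - Re b) - Re a) / 2"
  have r: "r > 0" "Re a + r < 1" "Re a + r + Re b < 1"
  proof -
    show "r > 0" using a by (auto simp: r_def)
    moreover have "2 * r \<le> 1 - Re a" "2 * r \<le> 1 - Re b - Re a"
      by (auto simp: r_def min_def)
    ultimately show "Re a + r < 1" "Re a + r + Re b < 1"
      by linarith+
  qed
  have re: "Re x \<le> Re a + r" if "x \<in> cball a r" for x
    using that abs_Re_le_cmod[of "a - x"] by (auto simp: dist_norm)
  obtain M where M: "summable M" "\<And>x y i. x \<in> cball a r \<Longrightarrow> y \<in> {b} \<Longrightarrow>
      norm (case prod_decode i of (j, k) \<Rightarrow> double_term x y j k) \<le> M i"
    by (rule double_term_bound[of "cball a r" "Re a + r" "{b}" "Re b"]) (use r re assms in auto)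
  thus "\<exists>d>0. \<exists>M. summable M \<and> (\<forall>y\<in>cball a d \<inter> {a. Re a < min 1 (1 - Re b)}. \<forall>n.
      norm (case prod_decode n of (j, k) \<Rightarrow> double_term y b j k) \<le> M n)"
    using r(1) by blast
qed (rule open_halfspace_Re_lt)

text \<open>Holomorphy is proved in the first variable only; the symmetry transfers the continuation
  argument to the second.\<close>

lemma double_sum_commute:
  assumes "(a, b) \<in> domain_ab"
  shows "double_sum a b = double_sum b a"
proof -
  have dom: "(b, a) \<in> domain_ab" using assms by (auto simp: domain_ab_def add.commute)
  have "((\<lambda>(j, k). double_term a b j k) has_sum double_sum a b) (UNIV \<times> UNIV)"
    using has_sum_nat_pairs[of "\<lambda>(j, k). double_term a b j k"] double_sum_abs_summable[OF assms]
    by (simp add: double_sum_def)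
  hence "((\<lambda>(j, k). double_term b a j k) has_sum double_sum a b) (UNIV \<times> UNIV)"
    by (subst (asm) has_sum_swap) (simp add: double_term_def mult_ac add_ac case_prod_unfold)
  moreover have "((\<lambda>(j, k). double_term b a j k) has_sum double_sum b a) (UNIV \<times> UNIV)"
    using has_sum_nat_pairs[of "\<lambda>(j, k). double_term b a j k"] double_sum_abs_summable[OF dom]
    by (simp add: double_sum_def)
  ultimately show ?thesis by (rule has_sum_unique)
qed

subsection \<open>The identity for real parameters and its continuation\<close>

lemma has_bochner_integral_pair_mult:
  fixes f g :: "real \<Rightarrow> real"
  assumes f: "has_bochner_integral lborel f I" and g: "has_bochner_integral lborel g J"
  shows "has_bochner_integral (lborel \<Otimes>\<^sub>M lborel) (\<lambda>(x, y). f x * g y) (I * J)"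
proof -
  have int: "integrable lborel f" "integrable lborel g" "integral\<^sup>L lborel f = I" "integral\<^sup>L lborel g = J"
    using assms by (auto simp: has_bochner_integral_iff)
  have [measurable]: "f \<in> borel_measurable lborel" "g \<in> borel_measurable lborel"
    using int by auto
  have *: "integrable (lborel \<Otimes>\<^sub>M lborel) (\<lambda>(x, y). f x * g y)"
  proof (rule lborel_pair.Fubini_integrable)
    show "integrable lborel (\<lambda>x. LINT y|lborel. norm (case (x, y) of (x, y) \<Rightarrow> f x * g y))"
      using int by (simp add: abs_mult)
  qed (use int in auto)
  have "integral\<^sup>L (lborel \<Otimes>\<^sub>M lborel) (\<lambda>(x, y). f x * g y) = (LINT x|lborel. LINT y|lborel. f x * g y)"
    using lborel_pair.integral_fst'[OF *] by simp
  with * int show ?thesis by (simp add: has_bochner_integral_iff)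
qed

section \<open>The double integral of the kernel\<close>

lemma nn_integral_mpow_exp:
  assumes "x > 0" "c > 0"
  shows "(\<integral>\<^sup>+t. ennreal (mpow x t * exp (- (c * t))) \<partial>lborel) = ennreal (Gamma x * c powr - x)"
  using has_bochner_integral_mpow_exp[OF assms]
  by (subst nn_integral_eq_integral) (auto simp: has_bochner_integral_iff)

text \<open>Writing 1 / (t + u) as the integral of e^(-(t + u) y) over y > 0 and exchanging the
  order splits the integral into two Gamma integrals. Nonnegative integrals make the exchange
  unconditional.\<close>

lemma nn_integral_mpow_divide_add:
  assumes b: "0 < b" "b < 1" and t: "t > 0"
  shows "(\<integral>\<^sup>+u. ennreal (mpow b u / (t + u)) \<partial>lborel) = ennreal (Gamma b * Gamma (1 - b) * mpow b t)"
proof -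
  have "(\<integral>\<^sup>+u. ennreal (mpow b u / (t + u)) \<partial>lborel) =
     (\<integral>\<^sup>+u. \<integral>\<^sup>+y. ennreal (mpow b u * (mpow 1 y * exp (- ((t + u) * y)))) \<partial>lborel \<partial>lborel)"
  proof (rule nn_integral_cong)
    fix u :: real
    show "ennreal (mpow b u / (t + u)) =
      (\<integral>\<^sup>+y. ennreal (mpow b u * (mpow 1 y * exp (- ((t + u) * y)))) \<partial>lborel)"
    proof (cases "u > 0")
      case True
      have "(\<integral>\<^sup>+y. ennreal (mpow b u * (mpow 1 y * exp (- ((t + u) * y)))) \<partial>lborel)
        = ennreal (mpow b u) * (\<integral>\<^sup>+y. ennreal (mpow 1 y * exp (- ((t + u) * y))) \<partial>lborel)"
        by (subst nn_integral_cmult[symmetric]) (auto simp: ennreal_mult)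
      also have "\<dots> = ennreal (mpow b u) * ennreal (Gamma 1 * (t + u) powr - 1)"
        using True t by (subst nn_integral_mpow_exp) auto
      also have "\<dots> = ennreal (mpow b u / (t + u))"
        using True t by (simp add: powr_minus divide_inverse flip: ennreal_mult)
      finally show ?thesis ..
    qed (simp add: mpow_def)
  qed
  also have "\<dots> = (\<integral>\<^sup>+y. \<integral>\<^sup>+u. ennreal (mpow b u * (mpow 1 y * exp (- ((t + u) * y)))) \<partial>lborel \<partial>lborel)"
    by (rule lborel_pair.Fubini') measurable
  also have "\<dots> = (\<integral>\<^sup>+y. ennreal (Gamma b) * ennreal (mpow (1 - b) y * exp (- (t * y))) \<partial>lborel)"
  proof (rule nn_integral_cong)
    fix y :: real
    show "(\<integral>\<^sup>+u. ennreal (mpow b u * (mpow 1 y * exp (- ((t + u) * y)))) \<partial>lborel)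
      = ennreal (Gamma b) * ennreal (mpow (1 - b) y * exp (- (t * y)))"
    proof (cases "y > 0")
      case True
      have "(\<integral>\<^sup>+u. ennreal (mpow b u * (mpow 1 y * exp (- ((t + u) * y)))) \<partial>lborel)
        = ennreal (exp (- (t * y))) * (\<integral>\<^sup>+u. ennreal (mpow b u * exp (- (y * u))) \<partial>lborel)"
        using True by (subst nn_integral_cmult[symmetric])
          (auto simp: mpow_def algebra_simps exp_add exp_diff exp_minus divide_inverse simp flip: ennreal_mult)
      also have "\<dots> = ennreal (exp (- (t * y))) * ennreal (Gamma b * y powr - b)"
        using True b by (subst nn_integral_mpow_exp) auto
      also have "\<dots> = ennreal (Gamma b) * ennreal (mpow (1 - b) y * exp (- (t * y)))"
        using True b by (simp add: mpow_def mult_ac Gamma_real_pos less_imp_le flip: ennreal_mult)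
      finally show ?thesis .
    qed (simp add: mpow_def)
  qed
  also have "\<dots> = ennreal (Gamma b) * ennreal (Gamma (1 - b) * t powr - (1 - b))"
    using b t by (subst nn_integral_cmult, measurable, subst nn_integral_mpow_exp) auto
  also have "\<dots> = ennreal (Gamma b * Gamma (1 - b) * mpow b t)"
    using b t by (simp add: mpow_def Gamma_real_pos less_imp_le mult_ac flip: ennreal_mult)
  finally show ?thesis .
qed

lemma bose_tail_2: "bose_tail 2 t = bose t - 1 / t + 1 / 2" if "t > 0"
  using that bcoeff_1 by (simp add: bose_tail_def numeral_2_eq_2 bcoeff_0 field_simps)

lemma bose_tail_1: "bose_tail 1 t = bose t - 1 / t"
  by (simp add: bose_tail_def bcoeff_0)

lemma bose_le_inverse: "bose t \<le> 1 / t" if "t > 0"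
proof -
  have "t \<le> exp t - 1" using exp_ge_add_one_self[of t] by linarith
  thus ?thesis unfolding bose_def using that by (intro divide_left_mono) auto
qed

text \<open>The function equals ((t - 2) e^t + t + 2) / (2 t (e^t - 1)), whose numerator vanishes at
  0 and has a nonnegative derivative. The sign makes Tonelli's theorem applicable to the
  kernel.\<close>

lemma bose_tail_2_nonneg: "0 \<le> bose_tail 2 t" if t: "t > 0"
proof -
  have deriv: "((\<lambda>t. (t - 2) * exp t + t + 2) has_real_derivative (x - 1) * exp x + 1) (at x)" for x
    by (auto intro!: derivative_eq_intros simp: algebra_simps)
  have "0 \<le> (x - 1) * exp x + 1" for x :: real
  proof -
    have "(1 - x) * exp x \<le> exp (- x) * exp x"
      using exp_ge_add_one_self[of "- x"] by (intro mult_right_mono) auto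
    thus ?thesis by (simp add: algebra_simps flip: exp_add)
  qed
  hence "(0 - 2) * exp 0 + 0 + 2 \<le> (t - 2) * exp t + t + (2 :: real)"
    using t by (intro DERIV_nonneg_imp_nondecreasing[where f="\<lambda>t. (t - 2) * exp t + t + 2"]) (use deriv in auto)
  hence "0 \<le> ((t - 2) * exp t + t + 2) / (2 * t * (exp t - 1))"
    using t by simp
  also have "\<dots> = bose_tail 2 t"
  proof -
    have "exp t \<noteq> 1" using t by simp
    thus ?thesis
      using t unfolding bose_tail_2[OF t] bose_def by (simp add: divide_simps) (simp add: algebra_simps)
  qed
  finally show ?thesis .
qed

text \<open>As the integrand is nonnegative, a single iterated computation yields integrability and
  value together.\<close>

lemma has_bochner_integral_bose_kernel:
  assumes "0 < a" "0 < b" "a + b < 1"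
  shows "has_bochner_integral (lborel \<Otimes>\<^sub>M lborel)
    (\<lambda>(t, u). mpow a t * mpow b u * bose_tail 2 t / (t + u))
    (Gamma b * Gamma (1 - b) * mellin_bose (a + b - 1))"
proof (rule has_bochner_integral_nn_integral)
  have M: "has_bochner_integral lborel (\<lambda>t. mpow (a + b - 1) t * bose_tail 2 t) (mellin_bose (a + b - 1))"
    \<comment> \<open>The exponent a + b - 1 lies in (-1, 0), the strip belonging to k = 2.\<close>
    by (rule has_bochner_integral_mellin_bose) (use assms in \<open>auto simp: less_2_cases_iff\<close>)
  have nn: "0 \<le> mpow s t * bose_tail 2 t" for s t
    using bose_tail_2_nonneg[of t] by (cases "t > 0") (auto simp: mpow_def)
  have "0 \<le> (LINT t|lborel. mpow (a + b - 1) t * bose_tail 2 t)"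
    by (intro Bochner_Integration.integral_nonneg nn)
  hence M0: "0 \<le> mellin_bose (a + b - 1)"
    using M by (simp add: has_bochner_integral_iff)
  show "0 \<le> Gamma b * Gamma (1 - b) * mellin_bose (a + b - 1)"
    using assms M0 by (auto intro!: mult_nonneg_nonneg less_imp_le[OF Gamma_real_pos])
  have nn2: "0 \<le> mpow a t * mpow b u * bose_tail 2 t / (t + u)" for t u
    using nn[of a t] by (cases "t > 0 \<and> u > 0") (auto simp: mpow_def zero_le_mult_iff)
  thus "AE p in lborel \<Otimes>\<^sub>M lborel. 0 \<le> (case p of (t, u) \<Rightarrow> mpow a t * mpow b u * bose_tail 2 t / (t + u))"
    by auto
  have "(\<integral>\<^sup>+p. ennreal (case p of (t, u) \<Rightarrow> mpow a t * mpow b u * bose_tail 2 t / (t + u)) \<partial>(lborel \<Otimes>\<^sub>M lborel))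
     = (\<integral>\<^sup>+t. \<integral>\<^sup>+u. ennreal (mpow a t * mpow b u * bose_tail 2 t / (t + u)) \<partial>lborel \<partial>lborel)"
    by (subst lborel.nn_integral_fst[symmetric]) auto
  also have "\<dots> = (\<integral>\<^sup>+t. ennreal (Gamma b * Gamma (1 - b)) * ennreal (mpow (a + b - 1) t * bose_tail 2 t) \<partial>lborel)"
  proof (rule nn_integral_cong)
    fix t :: real
    show "(\<integral>\<^sup>+u. ennreal (mpow a t * mpow b u * bose_tail 2 t / (t + u)) \<partial>lborel)
      = ennreal (Gamma b * Gamma (1 - b)) * ennreal (mpow (a + b - 1) t * bose_tail 2 t)"
    proof (cases "t > 0")
      case True
      have "(\<integral>\<^sup>+u. ennreal (mpow a t * mpow b u * bose_tail 2 t / (t + u)) \<partial>lborel)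
        = (\<integral>\<^sup>+u. ennreal (mpow a t * bose_tail 2 t) * ennreal (mpow b u / (t + u)) \<partial>lborel)"
      proof (rule nn_integral_cong)
        fix u
        have "0 \<le> mpow b u / (t + u)" using True by (cases "u > 0") (auto simp: mpow_def)
        thus "ennreal (mpow a t * mpow b u * bose_tail 2 t / (t + u))
          = ennreal (mpow a t * bose_tail 2 t) * ennreal (mpow b u / (t + u))"
          using nn[of a t] by (simp add: mult_ac flip: ennreal_mult)
      qed
      also have "\<dots> = ennreal (mpow a t * bose_tail 2 t) * ennreal (Gamma b * Gamma (1 - b) * mpow b t)"
        using assms True by (subst nn_integral_cmult, measurable, subst nn_integral_mpow_divide_add) auto
      also have "\<dots> = ennreal (Gamma b * Gamma (1 - b)) * ennreal (mpow (a + b - 1) t * bose_tail 2 t)"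
      proof -
        have "mpow a t * bose_tail 2 t * (Gamma b * Gamma (1 - b) * mpow b t) =
          Gamma b * Gamma (1 - b) * (mpow (a + b - 1) t * bose_tail 2 t)"
          by (simp add: mult_ac flip: mpow_mult_mpow)
        moreover have "0 \<le> Gamma b * Gamma (1 - b)"
          using assms by (auto intro!: mult_nonneg_nonneg less_imp_le[OF Gamma_real_pos])
        ultimately show ?thesis
          using nn[of a t] nn[of "a + b - 1" t] by (simp flip: ennreal_mult)
      qed
      finally show ?thesis .
    qed (simp add: mpow_def)
  qed
  also have "\<dots> = ennreal (Gamma b * Gamma (1 - b)) * (\<integral>\<^sup>+t. ennreal (mpow (a + b - 1) t * bose_tail 2 t) \<partial>lborel)"
    by (subst nn_integral_cmult) auto
  also have "(\<integral>\<^sup>+t. ennreal (mpow (a + b - 1) t * bose_tail 2 t) \<partial>lborel) = ennreal (mellin_bose (a + b - 1))"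
    using M nn by (subst nn_integral_eq_integral) (auto simp: has_bochner_integral_iff)
  also have "ennreal (Gamma b * Gamma (1 - b)) * ennreal (mellin_bose (a + b - 1)) =
      ennreal (Gamma b * Gamma (1 - b) * mellin_bose (a + b - 1))"
    using assms M0 by (auto intro!: ennreal_mult[symmetric] mult_nonneg_nonneg less_imp_le[OF Gamma_real_pos])
  finally show "(\<integral>\<^sup>+p. ennreal (case p of (t, u) \<Rightarrow> mpow a t * mpow b u * bose_tail 2 t / (t + u)) \<partial>(lborel \<Otimes>\<^sub>M lborel))
    = ennreal (Gamma b * Gamma (1 - b) * mellin_bose (a + b - 1))" .
qed auto

lemma has_bochner_integral_bose_kernel_sym:
  assumes "0 < a" "0 < b" "a + b < 1"
  shows "has_bochner_integral (lborel \<Otimes>\<^sub>M lborel)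
    (\<lambda>(t, u). mpow a t * mpow b u * ((bose_tail 2 t + bose_tail 2 u) / (t + u)))
    ((Gamma a * Gamma (1 - a) + Gamma b * Gamma (1 - b)) * mellin_bose (a + b - 1))"
proof -
  let ?f = "\<lambda>(u, t). mpow b u * mpow a t * bose_tail 2 u / (u + t)"
  have f: "has_bochner_integral (lborel \<Otimes>\<^sub>M lborel) ?f (Gamma a * Gamma (1 - a) * mellin_bose (b + a - 1))"
    by (rule has_bochner_integral_bose_kernel) (use assms in auto)
  hence "has_bochner_integral (lborel \<Otimes>\<^sub>M lborel) (\<lambda>(t, u). ?f (u, t))
      (Gamma a * Gamma (1 - a) * mellin_bose (b + a - 1))"
    unfolding has_bochner_integral_iff
    using lborel_pair.integrable_product_swap[of ?f] lborel_pair.integral_product_swap[of ?f]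
    by (simp add: borel_measurable_integrable)
  from has_bochner_integral_add[OF has_bochner_integral_bose_kernel[OF assms] this]
  show ?thesis
    by (simp add: case_prod_unfold algebra_simps add_divide_distrib)
qed

section \<open>Pointwise summation of the kernel series\<close>

lemma antidiagonal_sums:
  fixes f :: "nat \<times> nat \<Rightarrow> 'a::banach"
  assumes "(f has_sum S) UNIV"
  shows "(\<lambda>n. \<Sum>j\<le>n. f (j, n - j)) sums S"
proof -
  have "((\<lambda>(n, j). f (j, n - j)) has_sum S) (SIGMA n:UNIV. {..n}) \<longleftrightarrow> (f has_sum S) UNIV"
    by (rule has_sum_reindex_bij_witness[where i="\<lambda>(j, k). (j + k, j)" and j="\<lambda>(n, j). (j, n - j)"]) auto
  with assms have "((\<lambda>(n, j). f (j, n - j)) has_sum S) (SIGMA n:UNIV. {..n})" by simp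
  hence "((\<lambda>n. \<Sum>j\<le>n. f (j, n - j)) has_sum S) UNIV"
    by (rule has_sum_SigmaD) (auto intro: has_sum_finite)
  thus ?thesis by (rule has_sum_imp_sums)
qed

text \<open>These are the A_j of the overview. The subtraction at j = 0 removes the pole of
  \<open>bose\<close> at 0, so that the Mellin integral converges for 0 < a < 1.\<close>

definition bose_term :: "nat \<Rightarrow> real \<Rightarrow> real" where
  "bose_term j t = t ^ j / fact j * bose t - (if j = 0 then 1 / t else 0)"

lemma bose_term_measurable [measurable]: "bose_term j \<in> borel_measurable borel"
  unfolding bose_term_def by measurable

lemma exp_minus_1_sums:
  assumes "x \<noteq> (0::real)"
  shows "(\<lambda>n. x ^ n / fact n / real (n + 1)) sums ((exp x - 1) / x)"
proof -
  have "(\<lambda>n. x ^ n /\<^sub>R fact n) sums exp x" by (rule exp_converges)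
  hence "(\<lambda>n. x ^ Suc n /\<^sub>R fact (Suc n)) sums (exp x - 1)"
    by (subst sums_Suc_iff) simp
  hence "(\<lambda>n. x ^ Suc n /\<^sub>R fact (Suc n) / x) sums ((exp x - 1) / x)"
    by (rule sums_divide)
  moreover have "x ^ Suc n /\<^sub>R fact (Suc n) / x = x ^ n / fact n / real (n + 1)" for n
    using assms by (simp add: divide_inverse mult_ac)
  ultimately show ?thesis by (simp only:)
qed

lemma bose_term_abs_summable: "summable (\<lambda>j. \<bar>bose_term j t\<bar>)"
proof -
  have "summable (\<lambda>j. norm (t ^ j /\<^sub>R fact j) * \<bar>bose t\<bar>)"
    by (intro summable_mult2 summable_norm_exp)
  hence "summable (\<lambda>j. \<bar>bose_term (Suc j) t\<bar>)"
    by (subst (asm) summable_Suc_iff[symmetric]) (simp add: bose_term_def abs_mult divide_inverse mult_ac)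
  thus ?thesis by (subst (asm) summable_Suc_iff)
qed

lemma bose_term_double_abs_summable:
  "summable (\<lambda>i. norm (case prod_decode i of (j, k) \<Rightarrow> bose_term j t * bose_term k u / real (j + k + 1)))"
proof (rule summable_comparison_test'[where N=0])
  show "summable (\<lambda>i. case prod_decode i of (j, k) \<Rightarrow> \<bar>bose_term j t\<bar> * \<bar>bose_term k u\<bar>)"
    by (intro summable_prod_decode_mult bose_term_abs_summable) auto
  fix i
  obtain j k where jk: "prod_decode i = (j, k)" by force
  have "\<bar>bose_term j t * bose_term k u\<bar> / real (j + k + 1) \<le> \<bar>bose_term j t * bose_term k u\<bar> / 1"
    by (intro divide_left_mono) auto
  thus "norm (norm (case prod_decode i of (j, k) \<Rightarrow> bose_term j t * bose_term k u / real (j + k + 1)))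
      \<le> (case prod_decode i of (j, k) \<Rightarrow> \<bar>bose_term j t\<bar> * \<bar>bose_term k u\<bar>)"
    by (simp add: jk abs_mult)
qed

lemma bose_term_antidiagonal:
  "(\<Sum>j\<le>n. bose_term j t * bose_term (n - j) u) =
     bose t * bose u * ((t + u) ^ n / fact n) - bose u / t * (u ^ n / fact n)
      - bose t / u * (t ^ n / fact n) + (if n = 0 then 1 / (t * u) else 0)"
proof -
  \<comment> \<open>The corrections sit at j = 0 and at j = n; their product survives only when both
    ends coincide, that is for n = 0.\<close>
  have "(\<Sum>j\<le>n. bose_term j t * bose_term (n - j) u) =
    (\<Sum>j\<le>n. bose t * bose u * (t ^ j / fact j * (u ^ (n - j) / fact (n - j)))
       - (if j = 0 then bose u / t * (u ^ n / fact n) else 0)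
       - (if j = n then bose t / u * (t ^ n / fact n) else 0)
       + (if j = 0 then if n = 0 then 1 / (t * u) else 0 else 0))"
    by (intro sum.cong refl) (auto simp: bose_term_def algebra_simps)
  also have "\<dots> = bose t * bose u * (\<Sum>j\<le>n. t ^ j / fact j * (u ^ (n - j) / fact (n - j)))
     - bose u / t * (u ^ n / fact n) - bose t / u * (t ^ n / fact n) + (if n = 0 then 1 / (t * u) else 0)"
    by (simp add: sum.distrib sum_subtractf sum.delta sum_distrib_left)
  also have "(\<Sum>j\<le>n. t ^ j / fact j * (u ^ (n - j) / fact (n - j))) = (t + u) ^ n / fact n"
  proof -
    have "(t + u) ^ n / fact n = (\<Sum>j\<le>n. of_nat (n choose j) * t ^ j * u ^ (n - j)) / fact n"
      by (simp add: binomial_ring)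
    also have "\<dots> = (\<Sum>j\<le>n. t ^ j / fact j * (u ^ (n - j) / fact (n - j)))"
      unfolding sum_divide_distrib by (intro sum.cong refl) (simp add: binomial_fact)
    finally show ?thesis ..
  qed
  finally show ?thesis .
qed

lemma bose_term_double_sums:
  assumes t: "t > 0" and u: "u > 0"
  shows "(\<lambda>i. case prod_decode i of (j, k) \<Rightarrow> bose_term j t * bose_term k u / real (j + k + 1)) sums
    ((bose_tail 2 t + bose_tail 2 u) / (t + u))"
proof -
  let ?f = "\<lambda>(j, k). bose_term j t * bose_term k u / real (j + k + 1)"
  have "(\<lambda>n. \<Sum>j\<le>n. ?f (j, n - j)) sums (\<Sum>i. ?f (prod_decode i))"
    by (intro antidiagonal_sums has_sum_nat_pairs bose_term_double_abs_summable)
  also have "(\<lambda>n. \<Sum>j\<le>n. ?f (j, n - j)) = (\<lambda>n. bose t * bose u * ((t + u) ^ n / fact n / real (n + 1))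
      - bose u / t * (u ^ n / fact n / real (n + 1)) - bose t / u * (t ^ n / fact n / real (n + 1))
      + (if n = 0 then 1 / (t * u) else 0))"
  proof
    fix n
    have "(\<Sum>j\<le>n. ?f (j, n - j)) = (\<Sum>j\<le>n. bose_term j t * bose_term (n - j) u) / real (n + 1)"
      unfolding sum_divide_distrib by (intro sum.cong refl) auto
    thus "(\<Sum>j\<le>n. ?f (j, n - j)) = bose t * bose u * ((t + u) ^ n / fact n / real (n + 1))
      - bose u / t * (u ^ n / fact n / real (n + 1)) - bose t / u * (t ^ n / fact n / real (n + 1))
      + (if n = 0 then 1 / (t * u) else 0)"
      unfolding bose_term_antidiagonal by (auto simp: add_divide_distrib diff_divide_distrib)
  qed
  finally have 1: "\<dots> sums (\<Sum>i. ?f (prod_decode i))" .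
  have "(\<lambda>n. bose t * bose u * ((t + u) ^ n / fact n / real (n + 1))
      - bose u / t * (u ^ n / fact n / real (n + 1)) - bose t / u * (t ^ n / fact n / real (n + 1))
      + (if n = 0 then 1 / (t * u) else 0)) sums
      (bose t * bose u * ((exp (t + u) - 1) / (t + u)) - bose u / t * ((exp u - 1) / u)
        - bose t / u * ((exp t - 1) / t) + 1 / (t * u))"
    by (intro sums_add sums_diff sums_mult exp_minus_1_sums sums_single) (use t u in auto)
  from sums_unique2[OF 1 this]
  have "(\<Sum>i. ?f (prod_decode i)) = bose t * bose u * ((exp (t + u) - 1) / (t + u))
     - bose u / t * ((exp u - 1) / u) - bose t / u * ((exp t - 1) / t) + 1 / (t * u)" .
  also have "bose u / t * ((exp u - 1) / u) = 1 / (t * u)"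
    using t u by (simp add: bose_def)
  also have "bose t / u * ((exp t - 1) / t) = 1 / (t * u)"
    using t u by (simp add: bose_def)
  \<comment> \<open>With x = e^t - 1 and y = e^u - 1 one has e^(t + u) - 1 = (x + 1)(y + 1) - 1, and
    division by x y leaves 1/x + 1/y + 1.\<close>
  also have "bose t * bose u * ((exp (t + u) - 1) / (t + u)) = (bose t + bose u + 1) / (t + u)"
  proof -
    have "x \<noteq> 0 \<Longrightarrow> y \<noteq> 0 \<Longrightarrow> 1 / x * (1 / y) * ((x + 1) * (y + 1) - 1) = 1 / x + 1 / y + 1" for x y :: real
      by (simp add: field_simps)
    from this[of "exp t - 1" "exp u - 1"] show ?thesis
      using t u by (simp add: bose_def exp_add)
  qed
  \<comment> \<open>The surviving -1 / (t u) equals -(1/t + 1/u) / (t + u), and the 1 splits into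
    two halves, one for each \<open>bose_tail 2\<close>.\<close>
  also have "(bose t + bose u + 1) / (t + u) - 1 / (t * u) - 1 / (t * u) + 1 / (t * u) =
      (bose_tail 2 t + bose_tail 2 u) / (t + u)"
  proof -
    have "1 / t + 1 / u = (t + u) / (t * u)"
      using t u by (simp add: field_simps)
    hence "1 / (t * u) = (1 / t + 1 / u) / (t + u)"
      using t u by simp
    thus ?thesis
      using t u by (simp add: bose_tail_2 diff_divide_distrib add_divide_distrib)
  qed
  finally show ?thesis
    using summable_sums[OF summable_norm_cancel[OF bose_term_double_abs_summable[of t u]]] by simp
qed

section \<open>Exchange of the double series and the double integral\<close>

lemma has_bochner_integral_bose_term:
  assumes "0 < a" "a < 1"
  shows "has_bochner_integral lborel (\<lambda>t. mpow a t * bose_term j t) (mellin_bose (a + real j) / fact j)"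
    and "(LINT t|lborel. \<bar>mpow a t * bose_term j t\<bar>) = \<bar>mellin_bose (a + real j) / fact j\<bar>"
proof -
  show *: "has_bochner_integral lborel (\<lambda>t. mpow a t * bose_term j t) (mellin_bose (a + real j) / fact j)"
  proof (cases "j = 0")
    case True
    \<comment> \<open>For j = 0 the exponent lies in (0, 1), the strip k = 1; for j > 0 it exceeds 1
      and nothing needs to be subtracted.\<close>
    have "has_bochner_integral lborel (\<lambda>t. mpow a t * bose_tail 1 t) (mellin_bose a)"
      by (rule has_bochner_integral_mellin_bose) (use assms in auto)
    thus ?thesis using True by (simp add: bose_term_def bose_tail_1[unfolded One_nat_def])
  next
    case False
    have "has_bochner_integral lborel (\<lambda>t. mpow (a + real j) t * bose_tail 0 t) (mellin_bose (a + real j))"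
      by (rule has_bochner_integral_mellin_bose) (use assms False in auto)
    from has_bochner_integral_divide[OF this, of "fact j"]
    show ?thesis
      using False by (simp add: bose_term_def bose_tail_def mult.assoc flip: mpow_mult_power)
  qed
  have abs: "\<bar>LINT t|lborel. f t\<bar> = (LINT t|lborel. \<bar>f t\<bar>)"
    if "(\<forall>t. 0 \<le> f t) \<or> (\<forall>t. f t \<le> 0)" for f :: "real \<Rightarrow> real"
    using that
  proof
    assume "\<forall>t. 0 \<le> f t"
    thus ?thesis by (simp add: Bochner_Integration.integral_nonneg)
  next
    assume *: "\<forall>t. f t \<le> 0"
    hence "0 \<le> (LINT t|lborel. - f t)" by (intro Bochner_Integration.integral_nonneg) auto
    thus ?thesis using * by (simp add: abs_of_nonpos)
  qed
  \<comment> \<open>The integrand is nonpositive for j = 0, since 1 / (e^t - 1) \<le> 1 / t, and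
    nonnegative otherwise. Hence its L^1 norm is the modulus of its integral.\<close>
  have "(\<forall>t. 0 \<le> mpow a t * bose_term j t) \<or> (\<forall>t. mpow a t * bose_term j t \<le> 0)"
  proof (cases "j = 0")
    case True
    have "mpow a t * bose_term j t \<le> 0" for t
      using bose_le_inverse[of t] True by (auto simp: mpow_def bose_term_def mult_le_0_iff)
    thus ?thesis by blast
  next
    case False
    have "0 \<le> mpow a t * bose_term j t" for t
      using False by (auto simp: mpow_def bose_term_def bose_nonneg)
    thus ?thesis by blast
  qed
  from abs[OF this] show "(LINT t|lborel. \<bar>mpow a t * bose_term j t\<bar>) = \<bar>mellin_bose (a + real j) / fact j\<bar>"
    using * by (simp add: has_bochner_integral_iff)
qed

text \<open>This is Gamma(a + j) = (a)_j Gamma(a). For 0 < a < 1 the sum a + j is never 1, so the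
  limiting-value clause of \<open>pochhammer_zeta\<close> is not met.\<close>

lemma mellin_bose_eq_pochhammer_zeta:
  assumes "0 < a" "a < 1"
  shows "complex_of_real (mellin_bose (a + real j) / fact j) =
    Gamma (of_real a) * (pochhammer_zeta (of_real a) j / fact j)"
proof -
  have nz: "a + real j \<notin> \<int>"
  proof
    assume "a + real j \<in> \<int>"
    hence "a \<in> \<int>" by (metis Ints_diff Ints_of_nat add_diff_cancel_right')
    then obtain z :: int where "a = of_int z" by (auto elim: Ints_cases)
    thus False using assms by auto
  qed
  have ne: "complex_of_real a + of_nat j \<noteq> 1"
  proof
    assume "complex_of_real a + of_nat j = 1"
    hence "complex_of_real (a + real j) = of_real 1" by simp
    hence "a + real j = 1" by (simp only: of_real_eq_iff)
    thus False using nz by simp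
  qed
  have a: "complex_of_real a \<notin> \<int>\<^sub>\<le>\<^sub>0"
    using assms by (auto elim!: nonpos_Ints_cases simp: complex_eq_iff)
  have "complex_of_real (mellin_bose (a + real j)) = Gamma (of_real a + of_nat j) * zeta (of_real a + of_nat j)"
    using mellin_bose_eq_zeta[OF nz] by simp
  also have "Gamma (of_real a + of_nat j) = pochhammer (complex_of_real a) j * Gamma (of_real a)"
    using pochhammer_Gamma[OF a, of j] a by (simp add: Gamma_eq_zero_iff)
  finally show ?thesis
    using ne by (simp add: pochhammer_zeta_def)
qed

text \<open>Both sides are the integral of the symmetric kernel: once expanded into the double
  series and integrated termwise, once evaluated in closed form.\<close>

lemma double_sum_of_real:
  assumes "0 < a" "0 < b" "a + b < 1"
  shows "Gamma (of_real a) * Gamma (of_real b) * double_sum (of_real a) (of_real b) =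
    of_real ((Gamma a * Gamma (1 - a) + Gamma b * Gamma (1 - b)) * mellin_bose (a + b - 1))"
proof -
  have ab: "a < 1" "b < 1" using assms by auto
  let ?m = "\<lambda>a j. mellin_bose (a + real j) / fact j"
  let ?c = "\<lambda>(j, k). ?m a j * ?m b k / real (j + k + 1)"
  let ?K = "\<lambda>(t, u). mpow a t * mpow b u * ((bose_tail 2 t + bose_tail 2 u) / (t + u))"
  let ?F = "\<lambda>(j, k) (t, u). (mpow a t * bose_term j t) * (mpow b u * bose_term k u) / real (j + k + 1)"
  have c: "complex_of_real (?c p) = Gamma (of_real a) * Gamma (of_real b) *
      (case p of (j, k) \<Rightarrow> double_term (of_real a) (of_real b) j k)" for p
  proof -
    obtain j k where p: "p = (j, k)" by force
    have "complex_of_real (?c p) = complex_of_real (?m a j) * complex_of_real (?m b k) / of_nat (j + k + 1)"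
      by (simp add: p)
    also have "\<dots> = Gamma (of_real a) * Gamma (of_real b) * double_term (of_real a) (of_real b) j k"
      unfolding mellin_bose_eq_pochhammer_zeta[OF assms(1) ab(1)]
        mellin_bose_eq_pochhammer_zeta[OF assms(2) ab(2)] double_term_def by simp
    finally show ?thesis by (simp add: p)
  qed
  have dom: "(complex_of_real a, complex_of_real b) \<in> domain_ab"
    using assms by (auto simp: domain_ab_def)
  have "summable (\<lambda>i. norm (complex_of_real (?c (prod_decode i))))"
    unfolding c norm_mult using double_sum_abs_summable[OF dom]
    by (rule summable_mult[of _ "norm (Gamma (complex_of_real a)) * norm (Gamma (complex_of_real b))"])
  \<comment> \<open>These moduli are the L^1 norms of the terms of the kernel series, so their
    summability justifies termwise integration.\<close>
  hence smc: "summable (\<lambda>i. \<bar>?c (prod_decode i)\<bar>)" by (simp only: norm_of_real)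
  have "has_bochner_integral (lborel \<Otimes>\<^sub>M lborel) ?K (\<Sum>i. ?c (prod_decode i))"
  proof (rule has_bochner_integral_sums_abs[where f="\<lambda>i. ?F (prod_decode i)" and J="\<lambda>i. \<bar>?c (prod_decode i)\<bar>"])
    fix i
    obtain j k where jk: "prod_decode i = (j, k)" by force
    from has_bochner_integral_divide[OF has_bochner_integral_pair_mult[OF
        has_bochner_integral_bose_term(1)[OF assms(1) ab(1), of j]
        has_bochner_integral_bose_term(1)[OF assms(2) ab(2), of k]], of "real (j + k + 1)"]
    show "has_bochner_integral (lborel \<Otimes>\<^sub>M lborel) (?F (prod_decode i)) (?c (prod_decode i))"
      by (simp add: jk case_prod_unfold)
    have "has_bochner_integral lborel (\<lambda>t. \<bar>mpow a t * bose_term j t\<bar>) \<bar>?m a j\<bar>"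
      "has_bochner_integral lborel (\<lambda>t. \<bar>mpow b t * bose_term k t\<bar>) \<bar>?m b k\<bar>"
      using has_bochner_integral_bose_term[OF assms(1) ab(1), of j]
        has_bochner_integral_bose_term[OF assms(2) ab(2), of k]
      by (auto simp: has_bochner_integral_iff)
    from has_bochner_integral_divide[OF has_bochner_integral_pair_mult[OF this], of "real (j + k + 1)"]
    show "(LINT p|(lborel \<Otimes>\<^sub>M lborel). \<bar>?F (prod_decode i) p\<bar>) \<le> \<bar>?c (prod_decode i)\<bar>"
      by (simp add: jk case_prod_unfold abs_mult has_bochner_integral_iff)
  next
    fix p :: "real \<times> real"
    obtain t u where p: "p = (t, u)" by force
    let ?g = "\<lambda>i. case prod_decode i of (j, k) \<Rightarrow> bose_term j t * bose_term k u / real (j + k + 1)"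
    have F: "?F (prod_decode i) p = mpow a t * mpow b u * ?g i" for i
      by (simp add: p case_prod_unfold)
    show "(\<lambda>i. ?F (prod_decode i) p) sums ?K p"
    proof (cases "t > 0 \<and> u > 0")
      case True
      hence "?g sums ((bose_tail 2 t + bose_tail 2 u) / (t + u))"
        by (intro bose_term_double_sums) auto
      from sums_mult[OF this, of "mpow a t * mpow b u"] show ?thesis
        unfolding F by (simp only: p prod.case)
    next
      case False
      hence z: "mpow a t * mpow b u = 0" by (auto simp: mpow_def)
      show ?thesis unfolding F by (simp only: p prod.case z mult_zero_left sums_zero)
    qed
    show "summable (\<lambda>i. \<bar>?F (prod_decode i) p\<bar>)"
      unfolding F abs_mult using bose_term_double_abs_summable[of t u]
      by (intro summable_mult) simp
  qed (rule smc)
  from has_bochner_integral_eq[OF this has_bochner_integral_bose_kernel_sym[OF assms]]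
  have val: "(\<Sum>i. ?c (prod_decode i)) =
    (Gamma a * Gamma (1 - a) + Gamma b * Gamma (1 - b)) * mellin_bose (a + b - 1)" .
  have "(\<lambda>i. complex_of_real (?c (prod_decode i))) sums of_real (\<Sum>i. ?c (prod_decode i))"
    by (rule sums_of_real[OF summable_sums[OF summable_rabs_cancel[OF smc]]])
  moreover have "(\<lambda>i. complex_of_real (?c (prod_decode i))) sums
      (Gamma (of_real a) * Gamma (of_real b) * double_sum (of_real a) (of_real b))"
    unfolding c double_sum_def
    by (rule sums_mult[OF summable_sums[OF summable_norm_cancel[OF double_sum_abs_summable[OF dom]]]])
  ultimately have "of_real (\<Sum>i. ?c (prod_decode i)) =
      Gamma (of_real a) * Gamma (of_real b) * double_sum (of_real a) (of_real b)"
    by (rule sums_unique2)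
  thus ?thesis unfolding val by (rule sym)
qed

text \<open>The closed form divided by \<open>\<Gamma>(a + b - 1)\<close>, which is holomorphic on the whole domain.\<close>

definition zeta_rhs :: "complex \<Rightarrow> complex \<Rightarrow> complex" where
  "zeta_rhs a b = zeta (a + b - 1) * (Gamma (1 - a) * rGamma b + Gamma (1 - b) * rGamma a)"

lemma double_sum_identity_real:
  assumes "0 < a" "0 < b" "a + b < 1"
  shows "rGamma (of_real a + of_real b - 1) * double_sum (of_real a) (of_real b)
    = zeta_rhs (of_real a) (of_real b)"
proof -
  \<comment> \<open>The number lies strictly between -1 and 0, so Gamma is finite there and may be
    cancelled against 1 / Gamma.\<close>
  have s: "a + b - 1 \<notin> \<int>"
  proof
    assume "a + b - 1 \<in> \<int>"
    then obtain z :: int where "a + b - 1 = of_int z" by (rule Ints_cases)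
    hence "of_int z < (0::real)" "of_int z > (- 1 :: real)" using assms by auto
    thus False by auto
  qed
  have g: "Gamma (complex_of_real a) \<noteq> 0" "Gamma (complex_of_real b) \<noteq> 0"
    using assms by (auto simp: Gamma_eq_zero_iff of_real_in_nonpos_Ints_iff elim!: nonpos_Ints_cases)
  have "complex_of_real (a + b - 1) \<notin> \<int>\<^sub>\<le>\<^sub>0"
    using s nonpos_Ints_subset_Ints by (auto simp: of_real_in_nonpos_Ints_iff simp del: of_real_add of_real_diff)
  hence s': "rGamma (of_real a + of_real b - 1) * Gamma (complex_of_real a + of_real b - 1) = 1"
    by (simp add: Gamma_def rGamma_eq_zero_iff)
  have M: "of_real (mellin_bose (a + b - 1)) =
      Gamma (complex_of_real a + of_real b - 1) * zeta (of_real a + of_real b - 1)"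
    using mellin_bose_eq_zeta[OF s] by simp
  let ?A = "complex_of_real a" and ?B = "complex_of_real b"
  have "Gamma ?A * Gamma ?B * double_sum ?A ?B = (Gamma ?A * Gamma (1 - ?A) + Gamma ?B * Gamma (1 - ?B)) *
      (Gamma (?A + ?B - 1) * zeta (?A + ?B - 1))"
    using double_sum_of_real[OF assms] M
    by (simp add: Gamma_complex_of_real[symmetric] del: Gamma_complex_of_real)
  hence "double_sum ?A ?B = (Gamma (1 - ?A) / Gamma ?B + Gamma (1 - ?B) / Gamma ?A) *
      (Gamma (?A + ?B - 1) * zeta (?A + ?B - 1))"
    using g by (simp add: field_simps)
  hence "rGamma (?A + ?B - 1) * double_sum ?A ?B =
      (rGamma (?A + ?B - 1) * Gamma (?A + ?B - 1)) * zeta (?A + ?B - 1) *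
      (Gamma (1 - ?A) / Gamma ?B + Gamma (1 - ?B) / Gamma ?A)"
    by (simp only: mult_ac)
  thus ?thesis
    unfolding s' by (simp add: zeta_rhs_def Gamma_def divide_inverse)
qed

section \<open>Continuation in each parameter and the closed form\<close>

lemma zeta_rhs_holomorphic:
  assumes "Re b < 1"
  shows "(\<lambda>a. zeta_rhs a b) holomorphic_on {a. Re a < min 1 (1 - Re b)}"
proof -
  have "(zeta \<circ> (\<lambda>a. a + b - 1)) holomorphic_on {a. Re a < min 1 (1 - Re b)}"
  proof (rule holomorphic_on_compose_gen[OF _ zeta_holomorphic])
    \<comment> \<open>Here Re (a + b - 1) < 0, so the pole of \<open>zeta\<close> is not
      met.\<close>
    show "(\<lambda>a. a + b - 1) ` {a. Re a < min 1 (1 - Re b)} \<subseteq> - {1}"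
      by (auto simp: complex_eq_iff)
  qed (intro holomorphic_intros)
  moreover have "(\<lambda>a. Gamma (1 - a)) holomorphic_on {a. Re a < min 1 (1 - Re b)}"
    by (rule holomorphic_Gamma') (auto intro!: holomorphic_intros elim!: nonpos_Ints_cases simp: complex_eq_iff)
  ultimately show ?thesis
    unfolding zeta_rhs_def o_def
    by (intro holomorphic_on_mult holomorphic_on_add holomorphic_on_const holomorphic_rGamma)
qed

lemma zeta_rhs_commute: "zeta_rhs a b = zeta_rhs b a"
  by (simp add: zeta_rhs_def add_ac)

text \<open>A real interval of values of the first parameter suffices for the identity theorem,
  since for fixed \<open>b\<close> the admissible half-plane is convex, hence connected.\<close>

lemma double_sum_identity_extend:
  assumes "(a, b) \<in> domain_ab" "l < u" "u \<le> min 1 (1 - Re b)"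
    and eq: "\<And>x. l < x \<Longrightarrow> x < u \<Longrightarrow> rGamma (of_real x + b - 1) * double_sum (of_real x) b = zeta_rhs (of_real x) b"
  shows "rGamma (a + b - 1) * double_sum a b = zeta_rhs a b"
proof -
  let ?S = "{a. Re a < min 1 (1 - Re b)}"
  have b: "Re b < 1" using assms by (simp add: domain_ab_def)
  have "rGamma (a + b - 1) * double_sum a b - zeta_rhs a b = 0"
  proof (rule analytic_continuation[where S="?S" and U="of_real ` {l<..<u}" and \<xi>="of_real ((l + u) / 2)"
        and f="\<lambda>a. rGamma (a + b - 1) * double_sum a b - zeta_rhs a b"])
    show "(\<lambda>a. rGamma (a + b - 1) * double_sum a b - zeta_rhs a b) holomorphic_on ?S"
      by (intro holomorphic_intros double_sum_holomorphic_left[OF b] zeta_rhs_holomorphic[OF b])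
    show "open ?S" by (rule open_halfspace_Re_lt)
    show "connected ?S" by (rule convex_connected[OF convex_halfspace_Re_lt])
    show "complex_of_real ((l + u) / 2) islimpt of_real ` {l<..<u}"
      using assms by (intro islimpt_of_real_image) auto
    show "complex_of_real ((l + u) / 2) \<in> ?S" "a \<in> ?S"
      using assms by (auto simp: domain_ab_def)
  qed (use assms in auto)
  thus ?thesis by simp
qed

lemma double_sum_identity:
  assumes "(a, b) \<in> domain_ab"
  shows "rGamma (a + b - 1) * double_sum a b = zeta_rhs a b"
proof -
  \<comment> \<open>First continuation: the second parameter is a fixed positive real
    \<open>y\<close>, and the identity is known for real first parameters in (0, 1 - y).\<close>
  have real: "rGamma (a + of_real y - 1) * double_sum a (of_real y) = zeta_rhs a (of_real y)"
    if "0 < y" "(a, of_real y) \<in> domain_ab" for a y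
  proof (rule double_sum_identity_extend[OF that(2), of 0 "1 - y"])
    show "0 < 1 - y" "1 - y \<le> min 1 (1 - Re (complex_of_real y))"
      using that by (auto simp: domain_ab_def)
    show "rGamma (of_real x + of_real y - 1) * double_sum (of_real x) (of_real y) = zeta_rhs (of_real x) (of_real y)"
      if "0 < x" "x < 1 - y" for x
      using that \<open>0 < y\<close> by (intro double_sum_identity_real) auto
  qed
  have dom: "(b, a) \<in> domain_ab" using assms by (auto simp: domain_ab_def add.commute)
  \<comment> \<open>Second continuation: \<open>a\<close> is now a fixed complex number, and by
    symmetry the other parameter may leave the interval of positive reals just treated.\<close>
  have "rGamma (b + a - 1) * double_sum b a = zeta_rhs b a"
  proof (rule double_sum_identity_extend[OF dom, of 0 "min 1 (1 - Re a)"])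
    show "0 < min 1 (1 - Re a)" using assms by (auto simp: domain_ab_def)
    fix y assume y: "0 < y" "y < min 1 (1 - Re a)"
    have d: "(a, of_real y) \<in> domain_ab" using y assms by (auto simp: domain_ab_def)
    show "rGamma (of_real y + a - 1) * double_sum (of_real y) a = zeta_rhs (of_real y) a"
      using real[OF y(1) d] double_sum_commute[OF d] by (simp add: add.commute zeta_rhs_commute)
  qed simp
  thus ?thesis
    using double_sum_commute[OF assms] by (simp add: add.commute zeta_rhs_commute)
qed

lemma double_sum_eq_closed_form:
  assumes "(a, b) \<in> regular_ab"
  shows "double_sum a b = closed_form a b"
proof -
  let ?s = "a + b - 1"
  have reg: "(a, b) \<in> domain_ab" "a \<notin> \<int>\<^sub>\<le>\<^sub>0" "b \<notin> \<int>\<^sub>\<le>\<^sub>0" "a + b \<notin> \<int>\<^sub>\<le>\<^sub>0"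
    using assms by (auto simp: regular_ab_def)
  have re: "Re a < 1" "Re b < 1" "Re (a + b) < 1" using reg(1) by (auto simp: domain_ab_def)
  \<comment> \<open>An integer value of a + b is at most 0 because Re (a + b) < 1, and regularity
    excludes those values.\<close>
  have "?s \<notin> \<int>\<^sub>\<le>\<^sub>0"
  proof
    assume "?s \<in> \<int>\<^sub>\<le>\<^sub>0"
    then obtain n :: int where n: "?s = of_int n" by (auto elim: nonpos_Ints_cases)
    hence ab: "a + b = of_int (n + 1)" by (simp add: algebra_simps)
    have "Re (of_int (n + 1)) < 1" using re(3) unfolding ab .
    hence "of_int (n + 1) < (1::real)" by (simp only: complex_Re_of_int)
    hence "n + 1 \<le> 0" by linarith
    thus False using ab reg(4) nonpos_Ints_of_int by metis
  qed
  hence s: "Gamma ?s * rGamma ?s = 1" by (simp add: Gamma_def rGamma_eq_zero_iff)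
  have refl: "Gamma x * Gamma (1 - x) = of_real pi / sin (of_real pi * x)" "Gamma x \<noteq> 0"
     "sin (of_real pi * x) \<noteq> 0" if "x \<notin> \<int>\<^sub>\<le>\<^sub>0" "Re x < 1" for x
  proof -
    show 1: "Gamma x * Gamma (1 - x) = of_real pi / sin (of_real pi * x)"
      by (rule Gamma_reflection_complex)
    show 2: "Gamma x \<noteq> 0" using that by (simp add: Gamma_eq_zero_iff)
    have "1 - x \<notin> \<int>\<^sub>\<le>\<^sub>0" using that(2) by (auto elim!: nonpos_Ints_cases simp: complex_eq_iff)
    hence "Gamma (1 - x) \<noteq> 0" by (simp add: Gamma_eq_zero_iff)
    \<comment> \<open>If the sine vanished, division by zero would make the right side of the
      reflection formula 0, while both Gamma factors on the left are nonzero.\<close>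
    with 1 2 show "sin (of_real pi * x) \<noteq> 0" by auto
  qed
  have A: "Gamma (1 - a) = of_real pi / (sin (of_real pi * a) * Gamma a)"
    using refl[OF reg(2) re(1)] by (simp add: field_simps)
  have B: "Gamma (1 - b) = of_real pi / (sin (of_real pi * b) * Gamma b)"
    using refl[OF reg(3) re(2)] by (simp add: field_simps)
  have "double_sum a b = Gamma ?s * (rGamma ?s * double_sum a b)"
    using s by (simp flip: mult.assoc)
  also have "\<dots> = Gamma ?s * zeta_rhs a b"
    using double_sum_identity[OF reg(1)] by simp
  also have "\<dots> = Gamma ?s * zeta ?s * (Gamma (1 - a) / Gamma b + Gamma (1 - b) / Gamma a)"
    by (simp add: zeta_rhs_def Gamma_def divide_inverse mult.assoc)
  also have "\<dots> = closed_form a b"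
    unfolding closed_form_def A B
    using refl(2,3)[OF reg(2) re(1)] refl(2,3)[OF reg(3) re(2)] by (simp add: field_simps)
  finally show ?thesis .
qed

theorem theorem3:
  fixes a b :: complex
  assumes "Re a < 1" and "Re b < 1" and "Re (a + b) < 1"
  shows "\<exists>S. (\<forall>j. summable (\<lambda>k. double_term a b j k)) \<and>
             (\<lambda>j. \<Sum>k. double_term a b j k) sums S \<and>
             ((a, b) \<in> regular_ab \<longrightarrow> S = closed_form a b) \<and>
             ((\<lambda>(x, y). closed_form x y) \<longlongrightarrow> S) (at (a, b) within regular_ab)"
proof -
  have dom: "(a, b) \<in> domain_ab" using assms by (simp add: domain_ab_def)
  have "((\<lambda>(x, y). double_sum x y) \<longlongrightarrow> (case (a, b) of (x, y) \<Rightarrow> double_sum x y)) (at (a, b) within regular_ab)"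
    by (rule filterlim_mono[OF double_sum_isCont[OF dom, unfolded isCont_def] order.refl at_le]) auto
  hence "((\<lambda>(x, y). double_sum x y) \<longlongrightarrow> double_sum a b) (at (a, b) within regular_ab)" by simp
  moreover have "eventually (\<lambda>p. (case p of (x, y) \<Rightarrow> double_sum x y) = (case p of (x, y) \<Rightarrow> closed_form x y))
      (at (a, b) within regular_ab)"
    unfolding eventually_at_filter
    by (rule always_eventually) (auto simp: double_sum_eq_closed_form)
  ultimately have lim: "((\<lambda>(x, y). closed_form x y) \<longlongrightarrow> double_sum a b) (at (a, b) within regular_ab)"
    by (rule Lim_transform_eventually)
  note sums = iterated_sums_prod_decode[OF double_sum_abs_summable[OF dom], folded double_sum_def]
  show ?thesis
  proof (intro exI[of _ "double_sum a b"] conjI allI impI)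
    show "summable (\<lambda>k. double_term a b j k)" for j by (rule sums(1))
    show "(\<lambda>j. \<Sum>k. double_term a b j k) sums double_sum a b" by (rule sums(2))
    show "double_sum a b = closed_form a b" if "(a, b) \<in> regular_ab"
      using that by (rule double_sum_eq_closed_form)
  qed (rule lim)
qed

end
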